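(* For any tense logic $L$, the set $\mathsf{PTAB}(L)$ of pretabular extensions of $L$, viewed as a subset of the Cantor space $2^\omega$ via the coding, is $\Pi^0_2(L)$.
   Context: Tense formulas are generated from a countable set $\mathsf{Prop}$ of propositional variables by $\phi::=p\mid\bot\mid\phi\land\psi\mid\phi\to\psi\mid\Box_0\phi\mid\Box_1\phi$. A tense logic is a set of tense formulas containing all propositional tautologies, the axioms $\Box_i(p\to q)\to\Box_i p\to\Box_i q$ for $i=0,1$, and the axioms $p\to\Box_0\lnot\Box_1\lnot p$ and $p\to\Box_1\lnot\Box_0\lnot p$, and closed under modus ponens, necessitation (for both boxes) and uniform substitution. An extension of $L$ is a tense logic $L'$ with $L\subseteq L'$; it is proper if $L'\neq L$. A tense logic is consistent if it is not the set of all formulas. A Kripke frame $\mathcal{F}=(F,R)$ is a nonempty set $F$ with a binary relation $R\subseteq F\times F$. A valuation $V:\mathsf{Prop}\to\mathcal{P}(F)$ extends to all formulas, with Boolean connectives interpreted by Boolean operations, $V(\Box_0\phi)=\{x:\forall y\,(Rxy\to y\in V(\phi))\}$ and $V(\Box_1\phi)=\{x:\forall y\,(Ryx\to y\in V(\phi))\}$. $\mathcal{F}\models\phi$ means $V(\phi)=F$ for all valuations $V$. A tense logic $L$ is tabular if there is a finite Kripke frame $\mathcal{F}$ such that for every formula $\phi$, $\phi\in L$ iff $\mathcal{F}\models\phi$. A tense logic is pretabular if it is not tabular while all its proper consistent extensions are tabular. $\mathsf{PTAB}(L)$ is the set of pretabular extensions of $L$. Coding: tense formulas are coded injectively and effectively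 by natural numbers through a fixed standard Gödel numbering, and a logic is identified with the set of codes of its formulas, i.e. with an element of $2^\omega$ (reals are identified with subsets of $\omega$). For $a\in2^\omega$, a set $X\subseteq2^\omega$ is $\Pi^0_2(a)$ if there is a predicate $R$, recursive with the parameter $a$, such that for all $b\in2^\omega$: $b\in X$ iff $\forall m_1\in\omega\,\exists m_2\in\omega\;R(m_1,m_2,b,a)$. *)

theory Defs
  imports Main "HOL-Library.Nat_Bijection"
begin

section \<open>Tense formulas and tense logics\<close>

datatype form =
    Var nat
  | Bot
  | And form form
  | Imp form form
  | Box0 form
  | Box1 form

abbreviation Neg :: "form \<Rightarrow> form" where
  "Neg \<phi> \<equiv> Imp \<phi> Bot"

primrec subst :: "(nat \<Rightarrow> form) \<Rightarrow> form \<Rightarrow> form" where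
  "subst s (Var p) = s p"
| "subst s Bot = Bot"
| "subst s (And \<phi> \<psi>) = And (subst s \<phi>) (subst s \<psi>)"
| "subst s (Imp \<phi> \<psi>) = Imp (subst s \<phi>) (subst s \<psi>)"
| "subst s (Box0 \<phi>) = Box0 (subst s \<phi>)"
| "subst s (Box1 \<phi>) = Box1 (subst s \<phi>)"

text \<open>Boolean evaluation. Variables and boxed formulas count as propositional atoms, so that
  a tautology is a formula which is true by its Boolean structure alone.\<close>

primrec bool_eval :: "(form \<Rightarrow> bool) \<Rightarrow> form \<Rightarrow> bool" where
  "bool_eval v (Var p) = v (Var p)"
| "bool_eval v Bot = False"
| "bool_eval v (And \<phi> \<psi>) = (bool_eval v \<phi> \<and> bool_eval v \<psi>)"
| "bool_eval v (Imp \<phi> \<psi>) = (bool_eval v \<phi> \<longrightarrow> bool_eval v \<psi>)"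
| "bool_eval v (Box0 \<phi>) = v (Box0 \<phi>)"
| "bool_eval v (Box1 \<phi>) = v (Box1 \<phi>)"

definition tautology :: "form \<Rightarrow> bool" where
  "tautology \<phi> \<longleftrightarrow> (\<forall>v. bool_eval v \<phi>)"

text \<open>The axioms are stated for two fixed distinct variables; their instances come from
  closure under substitution.\<close>

definition tense_axioms :: "form set" where
  "tense_axioms =
    (let p = Var 0; q = Var 1 in
     {Imp (Box0 (Imp p q)) (Imp (Box0 p) (Box0 q)),
      Imp (Box1 (Imp p q)) (Imp (Box1 p) (Box1 q)),
      Imp p (Box0 (Neg (Box1 (Neg p)))),
      Imp p (Box1 (Neg (Box0 (Neg p))))})"

definition tense_logic :: "form set \<Rightarrow> bool" where
  "tense_logic L \<longleftrightarrow>
     {\<phi>. tautology \<phi>} \<subseteq> L \<and>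
     tense_axioms \<subseteq> L \<and>
     (\<forall>\<phi> \<psi>. \<phi> \<in> L \<longrightarrow> Imp \<phi> \<psi> \<in> L \<longrightarrow> \<psi> \<in> L) \<and>
     (\<forall>\<phi>. \<phi> \<in> L \<longrightarrow> Box0 \<phi> \<in> L \<and> Box1 \<phi> \<in> L) \<and>
     (\<forall>\<phi> s. \<phi> \<in> L \<longrightarrow> subst s \<phi> \<in> L)"

definition consistent :: "form set \<Rightarrow> bool" where
  "consistent L \<longleftrightarrow> L \<noteq> UNIV"

definition extension :: "form set \<Rightarrow> form set \<Rightarrow> bool" where
  "extension L L' \<longleftrightarrow> tense_logic L' \<and> L \<subseteq> L'"

definition proper_extension :: "form set \<Rightarrow> form set \<Rightarrow> bool" where
  "proper_extension L L' \<longleftrightarrow> extension L L' \<and> L' \<noteq> L"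


section \<open>Kripke semantics\<close>

definition kripke_frame :: "'w set \<Rightarrow> ('w \<times> 'w) set \<Rightarrow> bool" where
  "kripke_frame F R \<longleftrightarrow> F \<noteq> {} \<and> R \<subseteq> F \<times> F"

primrec truth_set :: "'w set \<Rightarrow> ('w \<times> 'w) set \<Rightarrow> (nat \<Rightarrow> 'w set) \<Rightarrow> form \<Rightarrow> 'w set" where
  "truth_set F R V (Var p) = V p"
| "truth_set F R V Bot = {}"
| "truth_set F R V (And \<phi> \<psi>) = truth_set F R V \<phi> \<inter> truth_set F R V \<psi>"
| "truth_set F R V (Imp \<phi> \<psi>) = (F - truth_set F R V \<phi>) \<union> truth_set F R V \<psi>"
| "truth_set F R V (Box0 \<phi>) = {x \<in> F. \<forall>y\<in>F. (x, y) \<in> R \<longrightarrow> y \<in> truth_set F R V \<phi>}"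
| "truth_set F R V (Box1 \<phi>) = {x \<in> F. \<forall>y\<in>F. (y, x) \<in> R \<longrightarrow> y \<in> truth_set F R V \<phi>}"

definition valid :: "'w set \<Rightarrow> ('w \<times> 'w) set \<Rightarrow> form \<Rightarrow> bool" where
  "valid F R \<phi> \<longleftrightarrow> (\<forall>V. (\<forall>p. V p \<subseteq> F) \<longrightarrow> truth_set F R V \<phi> = F)"

text \<open>The worlds of a finite frame are taken to be natural numbers; by lemma
  \<open>tabularI\<close> below this is no restriction.\<close>

definition tabular :: "form set \<Rightarrow> bool" where
  "tabular L \<longleftrightarrow> tense_logic L \<and>
     (\<exists>(F :: nat set) R. kripke_frame F R \<and> finite F \<and> (\<forall>\<phi>. \<phi> \<in> L \<longleftrightarrow> valid F R \<phi>))"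

text \<open>Consistency is required of the proper extensions only, not of \<open>L\<close> itself. As frames are
  nonempty, the inconsistent logic is not tabular and hence satisfies this definition.\<close>

definition pretabular :: "form set \<Rightarrow> bool" where
  "pretabular L \<longleftrightarrow> tense_logic L \<and> \<not> tabular L \<and>
     (\<forall>L'. proper_extension L L' \<and> consistent L' \<longrightarrow> tabular L')"

definition PTAB :: "form set \<Rightarrow> form set set" where
  "PTAB L = {L'. extension L L' \<and> pretabular L'}"

lemma truth_set_subset: "(\<And>p. V p \<subseteq> F) \<Longrightarrow> truth_set F R V \<phi> \<subseteq> F"
  by (induction \<phi>) auto

lemma truth_set_image:
  assumes h: "inj_on h F" and V: "\<And>p. V p \<subseteq> F" and R: "R \<subseteq> F \<times> F"
  shows "truth_set (h ` F) (map_prod h h ` R) (\<lambda>p. h ` V p) \<phi> = h ` truth_set F R V \<phi>"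
proof -
  have sub: "truth_set F R V \<psi> \<subseteq> F" for \<psi>
    by (rule truth_set_subset) (rule V)
  have mem: "h y \<in> h ` truth_set F R V \<psi> \<longleftrightarrow> y \<in> truth_set F R V \<psi>" if "y \<in> F" for y \<psi>
    using inj_on_image_mem_iff[OF h that sub] .
  have edge: "(h x, h y) \<in> map_prod h h ` R \<longleftrightarrow> (x, y) \<in> R" if "x \<in> F" "y \<in> F" for x y
  proof
    assume "(h x, h y) \<in> map_prod h h ` R"
    then obtain u v where uv: "(u, v) \<in> R" "h x = h u" "h y = h v" by auto
    with R have "u \<in> F" "v \<in> F" by auto
    with uv that h show "(x, y) \<in> R" by (metis inj_onD)
  next
    assume "(x, y) \<in> R"
    then show "(h x, h y) \<in> map_prod h h ` R" by (force simp: image_iff)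
  qed
  show ?thesis
  proof (induction \<phi>)
    case (And \<phi> \<psi>)
    then show ?case using inj_on_image_Int[OF h sub sub] by simp
  next
    case (Imp \<phi> \<psi>)
    have "h ` (F - truth_set F R V \<phi>) = h ` F - h ` truth_set F R V \<phi>"
      by (rule inj_on_image_set_diff[OF h]) (use sub in auto)
    with Imp show ?case by (simp add: image_Un)
  next
    case (Box0 \<phi>)
    have "(\<forall>y\<in>h ` F. (h x, y) \<in> map_prod h h ` R \<longrightarrow> y \<in> h ` truth_set F R V \<phi>) \<longleftrightarrow>
        (\<forall>y\<in>F. (x, y) \<in> R \<longrightarrow> y \<in> truth_set F R V \<phi>)" if "x \<in> F" for x
      using that by (simp add: mem edge)
    with Box0 show ?case by (simp add: set_eq_iff image_iff) blast
  next
    case (Box1 \<phi>)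
    have "(\<forall>y\<in>h ` F. (y, h x) \<in> map_prod h h ` R \<longrightarrow> y \<in> h ` truth_set F R V \<phi>) \<longleftrightarrow>
        (\<forall>y\<in>F. (y, x) \<in> R \<longrightarrow> y \<in> truth_set F R V \<phi>)" if "x \<in> F" for x
      using that by (simp add: mem edge)
    with Box1 show ?case by (simp add: set_eq_iff image_iff) blast
  qed simp_all
qed

lemma validD: "valid F R \<phi> \<Longrightarrow> (\<And>p. V p \<subseteq> F) \<Longrightarrow> truth_set F R V \<phi> = F"
  by (simp add: valid_def)

lemma valid_image:
  assumes h: "inj_on h F" and R: "R \<subseteq> F \<times> F"
  shows "valid (h ` F) (map_prod h h ` R) \<phi> \<longleftrightarrow> valid F R \<phi>"
proof
  assume *: "valid (h ` F) (map_prod h h ` R) \<phi>"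
  show "valid F R \<phi>"
    unfolding valid_def
  proof (intro allI impI)
    fix V :: "nat \<Rightarrow> 'a set"
    assume V: "\<forall>p. V p \<subseteq> F"
    have "truth_set (h ` F) (map_prod h h ` R) (\<lambda>p. h ` V p) \<phi> = h ` F"
      by (rule validD[OF *]) (use V in \<open>simp add: image_mono\<close>)
    moreover have "truth_set (h ` F) (map_prod h h ` R) (\<lambda>p. h ` V p) \<phi> = h ` truth_set F R V \<phi>"
      by (rule truth_set_image[OF h _ R]) (use V in simp)
    ultimately have "h ` truth_set F R V \<phi> = h ` F" by simp
    moreover have "truth_set F R V \<phi> \<subseteq> F"
      by (rule truth_set_subset) (use V in simp)
    ultimately show "truth_set F R V \<phi> = F"
      using inj_on_image_eq_iff[OF h] by simp
  qed
next
  assume *: "valid F R \<phi>"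
  show "valid (h ` F) (map_prod h h ` R) \<phi>"
    unfolding valid_def
  proof (intro allI impI)
    fix W :: "nat \<Rightarrow> 'b set"
    assume W: "\<forall>p. W p \<subseteq> h ` F"
    define V where "V p = {x \<in> F. h x \<in> W p}" for p
    have V: "V p \<subseteq> F" for p unfolding V_def by auto
    have "(\<lambda>p. h ` V p) = W"
    proof
      show "h ` V p = W p" for p
        using spec[OF W, of p] unfolding V_def by auto
    qed
    then have "truth_set (h ` F) (map_prod h h ` R) W \<phi> = h ` truth_set F R V \<phi>"
      using truth_set_image[where V = V and \<phi> = \<phi>, OF h V R] by simp
    also have "truth_set F R V \<phi> = F"
      by (rule validD[OF *]) (rule V)
    finally show "truth_set (h ` F) (map_prod h h ` R) W \<phi> = h ` F" .
  qed
qed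

lemma tabularI:
  fixes F :: "'w set"
  assumes "tense_logic L" and "kripke_frame F R" and "finite F"
    and "\<And>\<phi>. \<phi> \<in> L \<longleftrightarrow> valid F R \<phi>"
  shows "tabular L"
proof -
  obtain h :: "'w \<Rightarrow> nat" where h: "inj_on h F"
    using finite_imp_inj_to_nat_seg[OF assms(3)] by blast
  have R: "R \<subseteq> F \<times> F" and ne: "F \<noteq> {}"
    using assms(2) by (auto simp: kripke_frame_def)
  have "kripke_frame (h ` F) (map_prod h h ` R)"
    using R ne by (fastforce simp: kripke_frame_def)
  moreover have "\<forall>\<phi>. \<phi> \<in> L \<longleftrightarrow> valid (h ` F) (map_prod h h ` R) \<phi>"
    using valid_image[OF h R] assms(4) by blast
  ultimately show ?thesis
    using assms(1,3) unfolding tabular_def by blast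
qed


section \<open>Goedel numbering\<close>

text \<open>Elements of Cantor space are represented as sets of natural numbers.\<close>

primrec gcode :: "form \<Rightarrow> nat" where
  "gcode (Var p) = prod_encode (0, p)"
| "gcode Bot = prod_encode (1, 0)"
| "gcode (And \<phi> \<psi>) = prod_encode (2, prod_encode (gcode \<phi>, gcode \<psi>))"
| "gcode (Imp \<phi> \<psi>) = prod_encode (3, prod_encode (gcode \<phi>, gcode \<psi>))"
| "gcode (Box0 \<phi>) = prod_encode (4, gcode \<phi>)"
| "gcode (Box1 \<phi>) = prod_encode (5, gcode \<phi>)"

lemma inj_gcode: "inj gcode"
proof (rule injI)
  fix \<phi> \<psi>
  assume "gcode \<phi> = gcode \<psi>"
  then show "\<phi> = \<psi>"
  proof (induction \<phi> arbitrary: \<psi>)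
    case (Var p) then show ?case by (cases \<psi>) auto
  next
    case Bot then show ?case by (cases \<psi>) auto
  next
    case (And \<phi>1 \<phi>2) then show ?case by (cases \<psi>) auto
  next
    case (Imp \<phi>1 \<phi>2) then show ?case by (cases \<psi>) auto
  next
    case (Box0 \<phi>) then show ?case by (cases \<psi>) auto
  next
    case (Box1 \<phi>) then show ?case by (cases \<psi>) auto
  qed
qed

definition code_logic :: "form set \<Rightarrow> nat set" where
  "code_logic L = gcode ` L"


section \<open>Relative recursiveness and the class of Pi-0-2 sets\<close>

text \<open>\<open>recursive_in a k f\<close> states that \<open>f(x\<^sub>0, \<dots>, x\<^sub>k\<^sub>-\<^sub>1, b)\<close>, with \<open>k\<close> number arguments
  (a list of length \<open>k\<close>) and one set argument \<open>b\<close>, is a total recursive functional with the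
  parameter \<open>a\<close>: it is obtained from the initial functions and the characteristic functions of
  \<open>a\<close> and \<open>b\<close> by composition, primitive recursion and minimisation of regular functionals.
  The values of \<open>f\<close> on lists of another length are irrelevant.\<close>

inductive recursive_in :: "nat set \<Rightarrow> nat \<Rightarrow> (nat list \<Rightarrow> nat set \<Rightarrow> nat) \<Rightarrow> bool"
  for a :: "nat set"
where
  zero: "recursive_in a k (\<lambda>xs b. 0)"
| succ: "recursive_in a 1 (\<lambda>xs b. Suc (xs ! 0))"
| proj: "i < k \<Longrightarrow> recursive_in a k (\<lambda>xs b. xs ! i)"
| param: "recursive_in a 1 (\<lambda>xs b. of_bool (xs ! 0 \<in> a))"
| arg: "recursive_in a 1 (\<lambda>xs b. of_bool (xs ! 0 \<in> b))"
| comp: "recursive_in a (length gs) f \<Longrightarrow> (\<forall>g \<in> set gs. recursive_in a k g) \<Longrightarrow>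
    recursive_in a k (\<lambda>xs b. f (map (\<lambda>g. g xs b) gs) b)"
| prec: "recursive_in a k f \<Longrightarrow> recursive_in a (Suc (Suc k)) g \<Longrightarrow>
    recursive_in a (Suc k)
      (\<lambda>xs b. rec_nat (f (tl xs) b) (\<lambda>n r. g (n # r # tl xs) b) (hd xs))"
| mu: "recursive_in a (Suc k) f \<Longrightarrow>
    (\<forall>xs b. length xs = k \<longrightarrow> (\<exists>n. f (n # xs) b = 0)) \<Longrightarrow>
    recursive_in a k (\<lambda>xs b. LEAST n. f (n # xs) b = 0)"

definition recursive_pred_in :: "nat set \<Rightarrow> (nat \<Rightarrow> nat \<Rightarrow> nat set \<Rightarrow> bool) \<Rightarrow> bool" where
  "recursive_pred_in a R \<longleftrightarrow>
     (\<exists>f. recursive_in a 2 f \<and> (\<forall>m1 m2 b. f [m1, m2] b = of_bool (R m1 m2 b)))"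

definition Pi02_in :: "nat set \<Rightarrow> nat set set \<Rightarrow> bool" where
  "Pi02_in a X \<longleftrightarrow>
     (\<exists>R. recursive_pred_in a R \<and> (\<forall>b. b \<in> X \<longleftrightarrow> (\<forall>m1. \<exists>m2. R m1 m2 b)))"

end

theory Submission
  imports Defs
begin

text \<open>
  Tabularity of a consistent tense logic has a Sigma-0-1 description. Let \<open>tab n\<close> be the formula
  which says that at most \<open>n\<close> points lie within distance \<open>n\<close>, distance being counted along
  \<open>R\<close> and its converse. A frame with at most \<open>n\<close> points validates \<open>tab n\<close>. Conversely, suppose that a
  consistent logic contains \<open>tab n\<close>. Distinct points of its canonical model are separated by
  formulas, so the substitution instances of \<open>tab n\<close> leave at most \<open>n\<close> points within distance
  \<open>n\<close>, and a connected set which gains a new point at each of \<open>n\<close> steps would be too big: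
  every component has at most \<open>n\<close> points. All subsets of a finite component are definable by
  formulas, hence the component validates the whole logic and not only the canonical valuation
  satisfies it. Up to isomorphism there are finitely many frames with at most \<open>n\<close> points, and the
  disjoint union of those that validate the logic is a finite frame which characterizes it. This is
  \<open>tabular_iff_tab\<close>.

  Consequently an extension \<open>L'\<close> of \<open>L\<close> is pretabular iff it is inconsistent or contains no \<open>tab n\<close>,
  and for each formula \<open>\<phi>\<close> outside \<open>L'\<close> the logic generated by \<open>L'\<close> and \<open>\<phi>\<close> contains some \<open>tab n\<close>
  (\<open>PTAB_iff\<close>): a logic between this one and the set of all formulas contains the same
  \<open>tab n\<close>, and the inconsistent logic contains every \<open>tab n\<close>. Generation is an inductive
  definition relative to \<open>L'\<close>, hence Sigma-0-1 in \<open>L'\<close>. The last condition therefore has the form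
  "for all \<open>\<phi>\<close> there is a derivation", and the remaining ones (the elements are codes of formulas, \<open>L\<close> is
  included, nothing new is derivable, no \<open>tab n\<close> belongs to \<open>L'\<close>) are at most as complex.

  The recursion theory needed for this is a calculus of closure properties: predicates are written as
  HOL terms over a list of numbers, and rules for connectives, bounded and unbounded quantifiers and
  inductive definitions (\<open>sigma01_clos\<close>) classify them by their shape.
\<close>

section \<open>Computable functionals\<close>

text \<open>Only lists of length \<open>k\<close> matter. Abstracting from the values elsewhere makes the notion invariant
  under rewriting of the functional with facts that presuppose the length (\<open>computable_cong\<close>).\<close>

definition computable :: "nat set \<Rightarrow> nat \<Rightarrow> (nat list \<Rightarrow> nat set \<Rightarrow> nat) \<Rightarrow> bool" where
  "computable a k f \<longleftrightarrow>
     (\<exists>g. recursive_in a k g \<and> (\<forall>xs b. length xs = k \<longrightarrow> g xs b = f xs b))"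

lemma computableI: "recursive_in a k f \<Longrightarrow> computable a k f"
  by (auto simp: computable_def)

lemma computable_cong:
  assumes "computable a k f" "\<And>xs b. length xs = k \<Longrightarrow> f xs b = g xs b"
  shows "computable a k g"
  using assms unfolding computable_def by metis

lemma computable_comp:
  assumes f: "computable a (length gs) f" and gs: "\<And>g. g \<in> set gs \<Longrightarrow> computable a k g"
  shows "computable a k (\<lambda>xs b. f (map (\<lambda>g. g xs b) gs) b)"
proof -
  obtain f' where f': "recursive_in a (length gs) f'"
      "\<And>xs b. length xs = length gs \<Longrightarrow> f' xs b = f xs b"
    using f by (auto simp: computable_def)
  have "\<forall>g\<in>set gs. \<exists>h. recursive_in a k h \<and> (\<forall>xs b. length xs = k \<longrightarrow> h xs b = g xs b)"
    using gs by (auto simp: computable_def)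
  then obtain G where G: "\<And>g. g \<in> set gs \<Longrightarrow> recursive_in a k (G g)"
      "\<And>g xs b. g \<in> set gs \<Longrightarrow> length xs = k \<Longrightarrow> G g xs b = g xs b"
    by metis
  have "recursive_in a k (\<lambda>xs b. f' (map (\<lambda>g. g xs b) (map G gs)) b)"
    by (rule recursive_in.comp) (use f' G in auto)
  moreover have "f' (map (\<lambda>g. g xs b) (map G gs)) b = f (map (\<lambda>g. g xs b) gs) b"
    if "length xs = k" for xs b
  proof -
    have "map (\<lambda>g. g xs b) (map G gs) = map (\<lambda>g. g xs b) gs"
      using G(2)[OF _ that] by simp
    then have "f' (map (\<lambda>g. g xs b) (map G gs)) b = f' (map (\<lambda>g. g xs b) gs) b"
      by (simp only:)
    then show ?thesis using f'(2) by simp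
  qed
  ultimately show ?thesis unfolding computable_def by blast
qed

lemma computable_nth: "i < k \<Longrightarrow> computable a k (\<lambda>xs b. xs ! i)"
  by (intro computableI recursive_in.proj)

text \<open>The binder rules below produce variables in the form \<open>hd (tl (\<dots> xs))\<close>.\<close>

lemma hd_tl_funpow: "i < length xs \<Longrightarrow> hd ((tl ^^ i) xs) = xs ! i"
proof (induction i arbitrary: xs)
  case 0
  then show ?case by (simp add: hd_conv_nth)
next
  case (Suc i)
  then show ?case by (cases xs) (simp_all add: funpow_swap1)
qed

lemma computable_var: "i < k \<Longrightarrow> computable a k (\<lambda>xs b. hd ((tl ^^ i) xs))"
  by (rule computable_cong[OF computable_nth[of i]]) (auto simp: hd_tl_funpow)

lemmas computable_vars = computable_var[of 0, simplified]
  computable_var[of "Suc 0", simplified]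
  computable_var[of "Suc (Suc 0)", simplified]
  computable_var[of "Suc (Suc (Suc 0))", simplified]
  computable_var[of "Suc (Suc (Suc (Suc 0)))", simplified]
  computable_var[of "Suc (Suc (Suc (Suc (Suc 0))))", simplified]
  computable_var[of "Suc (Suc (Suc (Suc (Suc (Suc 0)))))", simplified]
  computable_var[of "Suc (Suc (Suc (Suc (Suc (Suc (Suc 0))))))", simplified]
  computable_var[of "Suc (Suc (Suc (Suc (Suc (Suc (Suc (Suc 0)))))))", simplified]

text \<open>Terms play the role of de Bruijn terms: the argument list is the environment, and binding a variable
  pushes a value onto it. The lemma is simultaneous substitution together with weakening, the
  first \<open>j\<close> entries of the environment being discarded after the evaluation of \<open>ts\<close>.\<close>

lemma computable_subst:
  assumes h: "computable a (length ts + k) h"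
    and ts: "\<forall>t\<in>set ts. computable a (j + k) t"
  shows "computable a (j + k) (\<lambda>xs b. h (map (\<lambda>t. t xs b) ts @ drop j xs) b)"
proof -
  \<comment> \<open>Projections onto the entries that are kept.\<close>
  let ?gs = "ts @ map (\<lambda>i xs b. xs ! i) [j..<j + k]"
  have *: "map (\<lambda>g. g xs b) ?gs = map (\<lambda>t. t xs b) ts @ drop j xs"
    if "length xs = j + k" for xs b
    using that by (auto intro!: nth_equalityI)
  have "computable a (j + k) (\<lambda>xs b. h (map (\<lambda>g. g xs b) ?gs) b)"
    by (rule computable_comp) (use h ts in \<open>auto intro: computable_nth\<close>)
  then show ?thesis by (rule computable_cong) (simp only: *)
qed

lemma computable_let:
  assumes "computable a (Suc k) (\<lambda>xs b. F (hd xs) (tl xs) b)" "computable a k t"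
  shows "computable a k (\<lambda>xs b. F (t xs b) xs b)"
  using computable_subst[where ts = "[t]" and j = 0 and h = "\<lambda>xs b. F (hd xs) (tl xs) b"] assms
  by simp

lemma computable_tl: "computable a k h \<Longrightarrow> computable a (Suc k) (\<lambda>xs b. h (tl xs) b)"
  using computable_subst[where ts = "[]" and j = "Suc 0"] by (simp add: drop_Suc)

lemma computable_Suc: "computable a k f \<Longrightarrow> computable a k (\<lambda>xs b. Suc (f xs b))"
  using computable_comp[where gs = "[f]", of a "\<lambda>xs b. Suc (xs ! 0)" k]
    computableI[OF recursive_in.succ] by simp

lemma computable_const: "computable a k (\<lambda>xs b. c)"
  by (induction c) (auto intro: computableI recursive_in.zero computable_Suc)

lemma computable_in_param: "computable a k f \<Longrightarrow> computable a k (\<lambda>xs b. of_bool (f xs b \<in> a))"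
  using computable_comp[where gs = "[f]", of a "\<lambda>xs b. of_bool (xs ! 0 \<in> a)" k]
    computableI[OF recursive_in.param] by simp

lemma computable_in_arg: "computable a k f \<Longrightarrow> computable a k (\<lambda>xs b. of_bool (f xs b \<in> b))"
  using computable_comp[where gs = "[f]", of a "\<lambda>xs b. of_bool (xs ! 0 \<in> b)" k]
    computableI[OF recursive_in.arg] by simp

text \<open>The step functional may use the environment \<open>xs\<close> directly, which turns primitive recursion into a
  rule that unifies with an arbitrary \<open>rec_nat\<close> term.\<close>

lemma computable_rec:
  assumes z: "computable a k z"
    and s: "computable a (Suc (Suc k)) (\<lambda>xs b. s (hd xs) (hd (tl xs)) (tl (tl xs)) b)"
    and t: "computable a k t"
  shows "computable a k (\<lambda>xs b. rec_nat (z xs b) (\<lambda>n r. s n r xs b) (t xs b))"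
proof -
  obtain z' where z': "recursive_in a k z'" "\<And>xs b. length xs = k \<Longrightarrow> z' xs b = z xs b"
    using z by (auto simp: computable_def)
  obtain s' where s': "recursive_in a (Suc (Suc k)) s'"
    "\<And>xs b. length xs = Suc (Suc k) \<Longrightarrow> s' xs b = s (hd xs) (hd (tl xs)) (tl (tl xs)) b"
    using s by (auto simp: computable_def)
  let ?F = "\<lambda>n xs b. rec_nat (z' xs b) (\<lambda>n r. s' (n # r # xs) b) n"
  have "computable a (Suc k) (\<lambda>xs b. ?F (hd xs) (tl xs) b)"
    by (intro computableI recursive_in.prec z' s')
  from computable_let[where F = ?F, OF this t] show ?thesis
    by (rule computable_cong) (simp add: z' s')
qed

lemma computable_add:
  assumes "computable a k f" "computable a k g"
  shows "computable a k (\<lambda>xs b. f xs b + g xs b)"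
proof -
  have "rec_nat m (\<lambda>_. Suc) n = m + n" for m n by (induction n) auto
  then show ?thesis
    using computable_rec[where s = "\<lambda>n r xs b. Suc r", OF assms(1) _ assms(2)]
    by (simp add: computable_Suc computable_vars)
qed

lemma computable_pred: "computable a k f \<Longrightarrow> computable a k (\<lambda>xs b. f xs b - 1)"
proof -
  assume f: "computable a k f"
  have "rec_nat 0 (\<lambda>n _. n) n = n - 1" for n :: nat by (cases n) auto
  then show ?thesis
    using computable_rec[where s = "\<lambda>n r xs b. n", OF computable_const[of _ _ 0] _ f]
    by (simp add: computable_vars)
qed

lemma computable_diff:
  assumes "computable a k f" "computable a k g"
  shows "computable a k (\<lambda>xs b. f xs b - g xs b)"
proof -
  have "rec_nat m (\<lambda>_ r. r - 1) n = m - n" for m n :: nat by (induction n) auto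
  then show ?thesis
    using computable_rec[where s = "\<lambda>n r xs b. r - 1", OF assms(1) _ assms(2)]
    by (simp add: computable_pred[simplified] computable_vars)
qed

lemma computable_mult:
  assumes f: "computable a k f" and g: "computable a k g"
  shows "computable a k (\<lambda>xs b. f xs b * g xs b)"
proof -
  have "computable a (Suc (Suc k)) (\<lambda>xs b. hd (tl xs) + f (tl (tl xs)) b)"
    by (intro computable_add computable_vars computable_tl[OF computable_tl[OF f]]) simp
  then have "computable a k (\<lambda>xs b. rec_nat 0 (\<lambda>_ r. r + f xs b) (g xs b))"
    using computable_rec[where s = "\<lambda>n r xs b. r + f xs b", OF computable_const[of _ _ 0] _ g]
    by simp
  moreover have "rec_nat 0 (\<lambda>_ r. r + m) n = m * n" for m n :: nat by (induction n) auto
  ultimately show ?thesis by simp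
qed

definition decidable :: "nat set \<Rightarrow> nat \<Rightarrow> (nat list \<Rightarrow> nat set \<Rightarrow> bool) \<Rightarrow> bool" where
  "decidable a k P \<longleftrightarrow> computable a k (\<lambda>xs b. of_bool (P xs b))"

lemma decidable_in_param: "computable a k f \<Longrightarrow> decidable a k (\<lambda>xs b. f xs b \<in> a)"
  unfolding decidable_def by (rule computable_in_param)

lemma decidable_in_arg: "computable a k f \<Longrightarrow> decidable a k (\<lambda>xs b. f xs b \<in> b)"
  unfolding decidable_def by (rule computable_in_arg)

lemma decidable_subst:
  assumes "decidable a (length ts + k) P" "\<forall>t\<in>set ts. computable a (j + k) t"
  shows "decidable a (j + k) (\<lambda>xs b. P (map (\<lambda>t. t xs b) ts @ drop j xs) b)"
  using assms unfolding decidable_def by (rule computable_subst)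

lemma decidable_tl: "decidable a k P \<Longrightarrow> decidable a (Suc k) (\<lambda>xs b. P (tl xs) b)"
  unfolding decidable_def by (rule computable_tl)

text \<open>Weakening below one bound variable, as needed when a further variable is bound in between.\<close>

lemma decidable_skip:
  assumes "decidable a (Suc k) (\<lambda>xs b. P (hd xs) (tl xs) b)"
  shows "decidable a (Suc (Suc k)) (\<lambda>xs b. P (hd xs) (tl (tl xs)) b)"
  using decidable_subst[where ts = "[\<lambda>xs b. hd xs]" and j = "Suc (Suc 0)"
      and P = "\<lambda>xs b. P (hd xs) (tl xs) b" and k = k] assms
  by (simp add: drop_Suc computable_vars)

lemma decidable_not:
  assumes "decidable a k P"
  shows "decidable a k (\<lambda>xs b. \<not> P xs b)"
proof -
  have "computable a k (\<lambda>xs b. 1 - of_bool (P xs b))"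
    using assms unfolding decidable_def by (intro computable_diff computable_const)
  moreover have "1 - of_bool p = (of_bool (\<not> p) :: nat)" for p by simp
  ultimately show ?thesis unfolding decidable_def by simp
qed

lemma decidable_and:
  assumes "decidable a k P" "decidable a k Q"
  shows "decidable a k (\<lambda>xs b. P xs b \<and> Q xs b)"
  using computable_mult[OF assms[unfolded decidable_def]]
  by (simp only: decidable_def of_bool_conj)

lemma decidable_or:
  assumes "decidable a k P" "decidable a k Q"
  shows "decidable a k (\<lambda>xs b. P xs b \<or> Q xs b)"
  using decidable_not[OF decidable_and[OF assms[THEN decidable_not]]] by simp

lemma decidable_le:
  assumes "computable a k f" "computable a k g"
  shows "decidable a k (\<lambda>xs b. f xs b \<le> g xs b)"
proof -
  have "computable a k (\<lambda>xs b. 1 - (f xs b - g xs b))"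
    by (intro computable_diff computable_const assms)
  moreover have "1 - (m - n) = of_bool (m \<le> n)" for m n :: nat by auto
  ultimately show ?thesis unfolding decidable_def by simp
qed

lemma decidable_less:
  assumes "computable a k f" "computable a k g"
  shows "decidable a k (\<lambda>xs b. f xs b < g xs b)"
  using decidable_le[OF computable_Suc[OF assms(1)] assms(2)] by (simp add: Suc_le_eq)

lemma decidable_eq:
  assumes "computable a k f" "computable a k g"
  shows "decidable a k (\<lambda>xs b. f xs b = g xs b)"
  using decidable_and[OF decidable_le[OF assms] decidable_le[OF assms(2,1)]]
  by (simp only: order_eq_iff)

text \<open>A bounded universal quantifier is a product of truth values.\<close>

lemma decidable_all_less:
  assumes P: "decidable a (Suc k) (\<lambda>xs b. P (hd xs) (tl xs) b)" and t: "computable a k t"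
  shows "decidable a k (\<lambda>xs b. \<forall>n<t xs b. P n xs b)"
proof -
  have 1: "computable a (Suc (Suc k)) (\<lambda>xs b. of_bool (P (hd xs) (tl (tl xs)) b))"
    using decidable_skip[OF P] unfolding decidable_def .
  have "computable a k (\<lambda>xs b. rec_nat 1 (\<lambda>n r. r * of_bool (P n xs b)) (t xs b))"
    by (rule computable_rec computable_const t computable_mult computable_vars 1 | simp only: zero_less_Suc Suc_less_eq)+
  moreover have "rec_nat 1 (\<lambda>n r. r * of_bool (p n)) m = (of_bool (\<forall>n<m. p n) :: nat)" for p m
    by (induction m) (simp_all add: All_less_Suc conj_commute flip: of_bool_conj)
  ultimately show ?thesis unfolding decidable_def by simp
qed

lemma decidable_ex_less:
  assumes "decidable a (Suc k) (\<lambda>xs b. P (hd xs) (tl xs) b)" "computable a k t"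
  shows "decidable a k (\<lambda>xs b. \<exists>n<t xs b. P n xs b)"
  using decidable_not[OF decidable_all_less[where P = "\<lambda>n xs b. \<not> P n xs b", OF decidable_not[OF assms(1)] assms(2)]]
  by simp

lemmas decidable_rules =
  decidable_in_param decidable_in_arg decidable_not decidable_and decidable_or
  decidable_le decidable_less decidable_eq decidable_all_less decidable_ex_less

lemmas computable_rules = computable_const computable_vars computable_Suc computable_add computable_diff computable_mult

text \<open>Halving satisfies \<open>Suc n div 2 = n - n div 2\<close>, a primitive recursion without case distinction.\<close>

lemma computable_half:
  assumes "computable a k f"
  shows "computable a k (\<lambda>xs b. f xs b div 2)"
proof -
  have "computable a k (\<lambda>xs b. rec_nat 0 (\<lambda>n r. n - r) (f xs b))"
    by (rule computable_rec) (intro computable_rules assms; simp)+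
  moreover have "rec_nat 0 (\<lambda>n r. n - r) n = n div 2" for n :: nat by (induction n) auto
  ultimately show ?thesis by simp
qed

lemma decidable_odd:
  assumes "computable a k f"
  shows "decidable a k (\<lambda>xs b. odd (f xs b))"
proof -
  have "decidable a k (\<lambda>xs b. f xs b \<noteq> f xs b div 2 + f xs b div 2)"
    by (intro decidable_rules computable_rules computable_half assms)
  moreover have "odd n \<longleftrightarrow> n \<noteq> n div 2 + n div 2" for n :: nat by presburger
  ultimately show ?thesis by simp
qed

lemma decidable_set_decode:
  assumes "computable a k f" "computable a k g"
  shows "decidable a k (\<lambda>xs b. f xs b \<in> set_decode (g xs b))"
proof -
  have "computable a k (\<lambda>xs b. rec_nat (g xs b) (\<lambda>n r. r div 2) (f xs b))"
    by (rule computable_rec) (intro computable_rules computable_half assms; simp)+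
  moreover have "rec_nat c (\<lambda>n r. r div 2) x = c div 2 ^ x" for c x :: nat
    by (induction x) (auto simp: div_mult2_eq mult.commute[of 2])
  ultimately show ?thesis unfolding set_decode_def by (simp add: decidable_odd)
qed

lemma computable_prod_encode:
  assumes "computable a k f" "computable a k g"
  shows "computable a k (\<lambda>xs b. prod_encode (f xs b, g xs b))"
proof -
  have "computable a k (\<lambda>xs b. rec_nat 0 (\<lambda>n r. r + Suc n) (f xs b + g xs b) + f xs b)"
    by (intro computable_add computable_rec) (intro computable_rules assms; simp)+
  moreover have "rec_nat 0 (\<lambda>n r. r + Suc n) n = triangle n" for n by (induction n) auto
  ultimately show ?thesis by (simp add: prod_encode_def)
qed

lemmas recursive_rules = decidable_rules decidable_set_decode computable_rules computable_prod_encode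

section \<open>The classes Sigma-0-1 and Pi-0-2\<close>

text \<open>The witness \<open>m\<close> is the front entry of the environment of the decidable matrix.\<close>

definition sigma01 :: "nat set \<Rightarrow> nat \<Rightarrow> (nat list \<Rightarrow> nat set \<Rightarrow> bool) \<Rightarrow> bool" where
  "sigma01 a k P \<longleftrightarrow> (\<exists>R. decidable a (Suc k) (\<lambda>xs b. R (hd xs) (tl xs) b) \<and>
     (\<forall>xs b. length xs = k \<longrightarrow> (P xs b \<longleftrightarrow> (\<exists>m. R m xs b))))"

lemma sigma01I:
  assumes "decidable a (Suc k) (\<lambda>xs b. R (hd xs) (tl xs) b)"
    and "\<And>xs b. length xs = k \<Longrightarrow> P xs b \<longleftrightarrow> (\<exists>m. R m xs b)"
  shows "sigma01 a k P"
  unfolding sigma01_def using assms by blast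

lemma sigma01E:
  assumes "sigma01 a k P"
  obtains R where "decidable a (Suc k) (\<lambda>xs b. R (hd xs) (tl xs) b)"
    and "\<And>xs b. length xs = k \<Longrightarrow> P xs b \<longleftrightarrow> (\<exists>m. R m xs b)"
  using assms unfolding sigma01_def by blast

lemma sigma01_decidable: "decidable a k P \<Longrightarrow> sigma01 a k P"
  by (rule sigma01I[where R = "\<lambda>m. P"]) (simp_all add: decidable_tl)

text \<open>Blocks of equal quantifiers are contracted by means of a common bound instead of a pairing function,
  so that no decoding has to be computed.\<close>

lemma ex_conj_bounded:
  "(\<exists>m. P m) \<and> (\<exists>n. Q n) \<longleftrightarrow> (\<exists>M::nat. (\<exists>m<M. P m) \<and> (\<exists>n<M. Q n))"
proof
  assume "(\<exists>m. P m) \<and> (\<exists>n. Q n)"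
  then obtain m n where "P m" "Q n" by blast
  moreover have "m < Suc (max m n)" "n < Suc (max m n)" by simp_all
  ultimately show "\<exists>M. (\<exists>m<M. P m) \<and> (\<exists>n<M. Q n)" by blast
qed blast

lemma ex_ex_bounded: "(\<exists>m n. P m n) \<longleftrightarrow> (\<exists>M::nat. \<exists>m<M. \<exists>n<M. P m n)"
proof
  assume "\<exists>m n. P m n"
  then obtain m n where "P m n" by blast
  moreover have "m < Suc (max m n)" "n < Suc (max m n)" by simp_all
  ultimately show "\<exists>M. \<exists>m<M. \<exists>n<M. P m n" by blast
qed blast

lemma sigma01_and:
  assumes "sigma01 a k P" "sigma01 a k Q"
  shows "sigma01 a k (\<lambda>xs b. P xs b \<and> Q xs b)"
proof -
  obtain R where R: "decidable a (Suc k) (\<lambda>xs b. R (hd xs) (tl xs) b)"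
      "\<And>xs b. length xs = k \<Longrightarrow> P xs b \<longleftrightarrow> (\<exists>m. R m xs b)"
    using assms(1) by (rule sigma01E) blast
  obtain R' where R': "decidable a (Suc k) (\<lambda>xs b. R' (hd xs) (tl xs) b)"
      "\<And>xs b. length xs = k \<Longrightarrow> Q xs b \<longleftrightarrow> (\<exists>m. R' m xs b)"
    using assms(2) by (rule sigma01E) blast
  show ?thesis
  proof (rule sigma01I[where R = "\<lambda>M xs b. (\<exists>m<M. R m xs b) \<and> (\<exists>n<M. R' n xs b)"])
    show "decidable a (Suc k)
        (\<lambda>xs b. (\<exists>m<hd xs. R m (tl xs) b) \<and> (\<exists>n<hd xs. R' n (tl xs) b))"
      by (intro decidable_and decidable_ex_less computable_vars decidable_skip R R') simp_all
  next
    fix xs :: "nat list" and b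
    assume "length xs = k"
    then show "P xs b \<and> Q xs b \<longleftrightarrow> (\<exists>M. (\<exists>m<M. R m xs b) \<and> (\<exists>n<M. R' n xs b))"
      by (simp only: R(2) R'(2), intro ex_conj_bounded)
  qed
qed

lemma sigma01_or:
  assumes "sigma01 a k P" "sigma01 a k Q"
  shows "sigma01 a k (\<lambda>xs b. P xs b \<or> Q xs b)"
proof -
  obtain R where R: "decidable a (Suc k) (\<lambda>xs b. R (hd xs) (tl xs) b)"
      "\<And>xs b. length xs = k \<Longrightarrow> P xs b \<longleftrightarrow> (\<exists>m. R m xs b)"
    using assms(1) by (rule sigma01E) blast
  obtain R' where R': "decidable a (Suc k) (\<lambda>xs b. R' (hd xs) (tl xs) b)"
      "\<And>xs b. length xs = k \<Longrightarrow> Q xs b \<longleftrightarrow> (\<exists>m. R' m xs b)"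
    using assms(2) by (rule sigma01E) blast
  show ?thesis
    by (rule sigma01I[where R = "\<lambda>m xs b. R m xs b \<or> R' m xs b"])
      (use R R' in \<open>auto intro: decidable_or\<close>)
qed

lemma sigma01_imp: "decidable a k P \<Longrightarrow> sigma01 a k Q \<Longrightarrow> sigma01 a k (\<lambda>xs b. P xs b \<longrightarrow> Q xs b)"
  unfolding imp_conv_disj by (rule sigma01_or[OF sigma01_decidable[OF decidable_not]])

text \<open>Here \<open>R\<close> keeps its two leading arguments, while the third entry of the environment, the common bound
  of both of them, is dropped. The lemma \<open>sigma01_drop_third\<close> does the same for a Sigma-0-1 matrix.\<close>

lemma decidable_drop_third:
  assumes "decidable a (Suc (Suc k)) (\<lambda>xs b. R (hd xs) (tl xs) b)"
  shows "decidable a (Suc (Suc (Suc k))) (\<lambda>xs b. R (hd xs) (hd (tl xs) # tl (tl (tl xs))) b)"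
  using decidable_subst[where ts = "[\<lambda>xs b. hd xs, \<lambda>xs b. hd (tl xs)]" and j = "Suc (Suc (Suc 0))"
      and P = "\<lambda>xs b. R (hd xs) (tl xs) b" and k = k and a = a] assms
  by (auto simp add: drop_Suc computable_vars)

lemma sigma01_ex:
  assumes "sigma01 a (Suc k) (\<lambda>xs b. P (hd xs) (tl xs) b)"
  shows "sigma01 a k (\<lambda>xs b. \<exists>n. P n xs b)"
proof -
  obtain R where R: "decidable a (Suc (Suc k)) (\<lambda>xs b. R (hd xs) (tl xs) b)"
      "\<And>xs b. length xs = Suc k \<Longrightarrow> P (hd xs) (tl xs) b \<longleftrightarrow> (\<exists>m. R m xs b)"
    using assms by (rule sigma01E) blast
  have R2: "P n xs b \<longleftrightarrow> (\<exists>m. R m (n # xs) b)" if "length xs = k" for n xs b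
    using R(2)[of "n # xs" b] that by simp
  show ?thesis
  proof (rule sigma01I[where R = "\<lambda>M xs b. \<exists>n<M. \<exists>m<M. R m (n # xs) b"])
    show "decidable a (Suc k) (\<lambda>xs b. \<exists>n<hd xs. \<exists>m<hd xs. R m (n # tl xs) b)"
      by (intro decidable_ex_less computable_vars decidable_drop_third R) simp_all
  next
    fix xs :: "nat list" and b
    assume "length xs = k"
    then show "(\<exists>n. P n xs b) \<longleftrightarrow> (\<exists>M. \<exists>n<M. \<exists>m<M. R m (n # xs) b)"
      by (simp only: R2, intro ex_ex_bounded)
  qed
qed

lemma bounded_collection:
  fixes t :: nat
  shows "(\<forall>n<t. \<exists>m. P n m) \<longleftrightarrow> (\<exists>M::nat. \<forall>n<t. \<exists>m<M. P n m)"
proof (induction t)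
  case (Suc t)
  show ?case
  proof
    assume "\<forall>n<Suc t. \<exists>m. P n m"
    then obtain M m where "\<forall>n<t. \<exists>m<M. P n m" "P t m" using Suc by auto
    then have "\<forall>n<Suc t. \<exists>m'<max M (Suc m). P n m'"
      by (auto simp: less_Suc_eq less_max_iff_disj)
    then show "\<exists>M. \<forall>n<Suc t. \<exists>m<M. P n m" by blast
  qed blast
qed simp

text \<open>Finitely many witnesses have a common bound, so a bounded universal quantifier can be moved inside.\<close>

lemma sigma01_all_less:
  assumes "sigma01 a (Suc k) (\<lambda>xs b. P (hd xs) (tl xs) b)" and t: "computable a k t"
  shows "sigma01 a k (\<lambda>xs b. \<forall>n<t xs b. P n xs b)"
proof -
  obtain R where R: "decidable a (Suc (Suc k)) (\<lambda>xs b. R (hd xs) (tl xs) b)"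
      "\<And>xs b. length xs = Suc k \<Longrightarrow> P (hd xs) (tl xs) b \<longleftrightarrow> (\<exists>m. R m xs b)"
    using assms(1) by (rule sigma01E) blast
  have R2: "P n xs b \<longleftrightarrow> (\<exists>m. R m (n # xs) b)" if "length xs = k" for n xs b
    using R(2)[of "n # xs" b] that by simp
  show ?thesis
  proof (rule sigma01I[where R = "\<lambda>M xs b. \<forall>n<t xs b. \<exists>m<M. R m (n # xs) b"])
    show "decidable a (Suc k) (\<lambda>xs b. \<forall>n<t (tl xs) b. \<exists>m<hd xs. R m (n # tl xs) b)"
      by (intro decidable_all_less decidable_ex_less computable_vars decidable_drop_third R computable_tl[OF t]) simp_all
  qed (simp only: R2, rule bounded_collection)
qed

lemma sigma01_subst:
  assumes P: "sigma01 a (length ts + k) P" and ts: "\<forall>t\<in>set ts. computable a (j + k) t"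
  shows "sigma01 a (j + k) (\<lambda>xs b. P (map (\<lambda>t. t xs b) ts @ drop j xs) b)"
proof -
  obtain R where R: "decidable a (Suc (length ts + k)) (\<lambda>xs b. R (hd xs) (tl xs) b)"
      "\<And>xs b. length xs = length ts + k \<Longrightarrow> P xs b \<longleftrightarrow> (\<exists>m. R m xs b)"
    using P by (rule sigma01E) blast
  show ?thesis
  proof (rule sigma01I[where R = "\<lambda>m xs b. R m (map (\<lambda>t. t xs b) ts @ drop j xs) b"])
    let ?ts = "(\<lambda>xs b. hd xs) # map (\<lambda>t xs b. t (tl xs) b) ts"
    have "decidable a (Suc j + k)
        (\<lambda>xs b. (\<lambda>xs b. R (hd xs) (tl xs) b) (map (\<lambda>t. t xs b) ?ts @ drop (Suc j) xs) b)"
      by (rule decidable_subst) (use R(1) ts in \<open>auto intro: computable_vars computable_tl\<close>)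
    then show "decidable a (Suc (j + k))
        (\<lambda>xs b. R (hd xs) (map (\<lambda>t. t (tl xs) b) ts @ drop j (tl xs)) b)"
      by (simp add: comp_def drop_Suc)
  qed (simp add: R(2))
qed

lemma sigma01_tl: "sigma01 a k P \<Longrightarrow> sigma01 a (Suc k) (\<lambda>xs b. P (tl xs) b)"
  using sigma01_subst[where ts = "[]" and j = "Suc 0"] by (simp add: drop_Suc)

lemma sigma01_skip:
  assumes "sigma01 a (Suc k) (\<lambda>xs b. P (hd xs) (tl xs) b)"
  shows "sigma01 a (Suc (Suc k)) (\<lambda>xs b. P (hd xs) (tl (tl xs)) b)"
  using sigma01_subst[where ts = "[\<lambda>xs b. hd xs]" and j = "Suc (Suc 0)"
      and P = "\<lambda>xs b. P (hd xs) (tl xs) b" and k = k] assms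
  by (simp add: drop_Suc computable_vars)

lemma sigma01_drop_third:
  assumes "sigma01 a (Suc (Suc k)) (\<lambda>xs b. R (hd xs) (tl xs) b)"
  shows "sigma01 a (Suc (Suc (Suc k))) (\<lambda>xs b. R (hd xs) (hd (tl xs) # tl (tl (tl xs))) b)"
  using sigma01_subst[where ts = "[\<lambda>xs b. hd xs, \<lambda>xs b. hd (tl xs)]" and j = "Suc (Suc (Suc 0))"
      and P = "\<lambda>xs b. R (hd xs) (tl xs) b" and k = k and a = a] assms
  by (auto simp add: drop_Suc computable_vars)

definition pi02 :: "nat set \<Rightarrow> nat \<Rightarrow> (nat list \<Rightarrow> nat set \<Rightarrow> bool) \<Rightarrow> bool" where
  "pi02 a k P \<longleftrightarrow> (\<exists>Q. sigma01 a (Suc k) (\<lambda>xs b. Q (hd xs) (tl xs) b) \<and>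
     (\<forall>xs b. length xs = k \<longrightarrow> (P xs b \<longleftrightarrow> (\<forall>m. Q m xs b))))"

lemma pi02I:
  assumes "sigma01 a (Suc k) (\<lambda>xs b. Q (hd xs) (tl xs) b)"
    and "\<And>xs b. length xs = k \<Longrightarrow> P xs b \<longleftrightarrow> (\<forall>m. Q m xs b)"
  shows "pi02 a k P"
  unfolding pi02_def using assms by blast

lemma pi02E:
  assumes "pi02 a k P"
  obtains Q where "sigma01 a (Suc k) (\<lambda>xs b. Q (hd xs) (tl xs) b)"
    and "\<And>xs b. length xs = k \<Longrightarrow> P xs b \<longleftrightarrow> (\<forall>m. Q m xs b)"
  using assms unfolding pi02_def by blast

lemma pi02_sigma: "sigma01 a k P \<Longrightarrow> pi02 a k P"
  by (rule pi02I[where Q = "\<lambda>m. P"]) (simp_all add: sigma01_tl)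

text \<open>A Pi-0-1 condition is a Pi-0-2 condition whose inner quantifier is idle.\<close>

lemma pi02_not_sigma:
  assumes "sigma01 a k P"
  shows "pi02 a k (\<lambda>xs b. \<not> P xs b)"
proof -
  obtain R where R: "decidable a (Suc k) (\<lambda>xs b. R (hd xs) (tl xs) b)"
      "\<And>xs b. length xs = k \<Longrightarrow> P xs b \<longleftrightarrow> (\<exists>m. R m xs b)"
    using assms(1) by (rule sigma01E) blast
  show ?thesis
    by (rule pi02I[where Q = "\<lambda>m xs b. \<not> R m xs b"])
      (use R in \<open>auto intro: sigma01_decidable decidable_not\<close>)
qed

lemma pi02_and:
  assumes "pi02 a k P" "pi02 a k P'"
  shows "pi02 a k (\<lambda>xs b. P xs b \<and> P' xs b)"
proof -
  obtain Q where Q: "sigma01 a (Suc k) (\<lambda>xs b. Q (hd xs) (tl xs) b)"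
      "\<And>xs b. length xs = k \<Longrightarrow> P xs b \<longleftrightarrow> (\<forall>m. Q m xs b)"
    using assms(1) by (rule pi02E) blast
  obtain Q' where Q': "sigma01 a (Suc k) (\<lambda>xs b. Q' (hd xs) (tl xs) b)"
      "\<And>xs b. length xs = k \<Longrightarrow> P' xs b \<longleftrightarrow> (\<forall>m. Q' m xs b)"
    using assms(2) by (rule pi02E) blast
  show ?thesis
    by (rule pi02I[where Q = "\<lambda>m xs b. Q m xs b \<and> Q' m xs b"])
      (use Q Q' in \<open>auto intro: sigma01_and\<close>)
qed

lemma pi02_or:
  assumes "pi02 a k P" "pi02 a k P'"
  shows "pi02 a k (\<lambda>xs b. P xs b \<or> P' xs b)"
proof -
  obtain Q where Q: "sigma01 a (Suc k) (\<lambda>xs b. Q (hd xs) (tl xs) b)"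
      "\<And>xs b. length xs = k \<Longrightarrow> P xs b \<longleftrightarrow> (\<forall>m. Q m xs b)"
    using assms(1) by (rule pi02E) blast
  obtain Q' where Q': "sigma01 a (Suc k) (\<lambda>xs b. Q' (hd xs) (tl xs) b)"
      "\<And>xs b. length xs = k \<Longrightarrow> P' xs b \<longleftrightarrow> (\<forall>m. Q' m xs b)"
    using assms(2) by (rule pi02E) blast
  show ?thesis
  proof (rule pi02I[where Q = "\<lambda>M xs b. (\<forall>m<M. Q m xs b) \<or> (\<forall>n<M. Q' n xs b)"])
    show "sigma01 a (Suc k)
        (\<lambda>xs b. (\<forall>m<hd xs. Q m (tl xs) b) \<or> (\<forall>n<hd xs. Q' n (tl xs) b))"
      by (intro sigma01_or sigma01_all_less computable_vars sigma01_skip Q Q') simp_all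
  next
    fix xs :: "nat list" and b
    assume "length xs = k"
    then show "P xs b \<or> P' xs b \<longleftrightarrow> (\<forall>M. (\<forall>m<M. Q m xs b) \<or> (\<forall>n<M. Q' n xs b))"
      using ex_conj_bounded[where P = "\<lambda>m. \<not> Q m xs b" and Q = "\<lambda>m. \<not> Q' m xs b"]
      by (simp only: Q(2) Q'(2)) blast
  qed
qed

lemma pi02_all:
  assumes "pi02 a (Suc k) (\<lambda>xs b. P (hd xs) (tl xs) b)"
  shows "pi02 a k (\<lambda>xs b. \<forall>n. P n xs b)"
proof -
  obtain Q where Q: "sigma01 a (Suc (Suc k)) (\<lambda>xs b. Q (hd xs) (tl xs) b)"
      "\<And>xs b. length xs = Suc k \<Longrightarrow> P (hd xs) (tl xs) b \<longleftrightarrow> (\<forall>m. Q m xs b)"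
    using assms by (rule pi02E) blast
  have Q2: "P n xs b \<longleftrightarrow> (\<forall>m. Q m (n # xs) b)" if "length xs = k" for n xs b
    using Q(2)[of "n # xs" b] that by simp
  show ?thesis
  proof (rule pi02I[where Q = "\<lambda>M xs b. \<forall>n<M. \<forall>m<M. Q m (n # xs) b"])
    show "sigma01 a (Suc k) (\<lambda>xs b. \<forall>n<hd xs. \<forall>m<hd xs. Q m (n # tl xs) b)"
      by (intro sigma01_all_less computable_vars sigma01_drop_third Q) simp_all
  next
    fix xs :: "nat list" and b
    assume "length xs = k"
    then show "(\<forall>n. P n xs b) \<longleftrightarrow> (\<forall>M. \<forall>n<M. \<forall>m<M. Q m (n # xs) b)"
      using ex_ex_bounded[where P = "\<lambda>n m. \<not> Q m (n # xs) b"] by (simp only: Q2) blast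
  qed
qed

lemma pi02_imp_sigma: "sigma01 a k P \<Longrightarrow> pi02 a k Q \<Longrightarrow> pi02 a k (\<lambda>xs b. P xs b \<longrightarrow> Q xs b)"
  unfolding imp_conv_disj by (rule pi02_or[OF pi02_not_sigma])

lemma Pi02_in_if_pi02:
  assumes "pi02 a 0 (\<lambda>xs b. b \<in> X)"
  shows "Pi02_in a X"
proof -
  obtain Q where Q: "sigma01 a (Suc 0) (\<lambda>xs b. Q (hd xs) (tl xs) b)"
      "\<And>b. b \<in> X \<longleftrightarrow> (\<forall>m. Q m [] b)"
    using assms by (rule pi02E) auto
  obtain R where R: "decidable a (Suc (Suc 0)) (\<lambda>xs b. R (hd xs) (tl xs) b)"
      "\<And>xs b. length xs = Suc 0 \<Longrightarrow> Q (hd xs) (tl xs) b \<longleftrightarrow> (\<exists>m. R m xs b)"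
    using Q(1) by (rule sigma01E) blast
  have "decidable a (Suc (Suc 0)) (\<lambda>xs b. R (hd (tl xs)) (hd xs # tl (tl xs)) b)"
    using decidable_subst[where ts = "[\<lambda>xs b. hd (tl xs), \<lambda>xs b. hd xs]" and j = "Suc (Suc 0)"
      and P = "\<lambda>xs b. R (hd xs) (tl xs) b" and k = 0 and a = a] R(1)
    by (auto simp add: drop_Suc computable_vars)
  then have "recursive_pred_in a (\<lambda>m1 m2 b. R m2 [m1] b)"
    unfolding decidable_def computable_def recursive_pred_in_def by (auto simp: numeral_2_eq_2)
  moreover have "b \<in> X \<longleftrightarrow> (\<forall>m1. \<exists>m2. R m2 [m1] b)" for b
    using Q(2) R(2)[of "[m]" for m] by auto
  ultimately show ?thesis unfolding Pi02_in_def by blast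
qed

section \<open>Inductive definitions are Sigma-0-1\<close>

text \<open>Every inductive definition needed below has rules with no premise (\<open>A\<close>) or two premises (\<open>T\<close>);
  a rule with a single premise ignores the second one.\<close>

inductive clos :: "(nat \<Rightarrow> bool) \<Rightarrow> (nat \<Rightarrow> nat \<Rightarrow> nat \<Rightarrow> bool) \<Rightarrow> nat \<Rightarrow> bool" for A T where
  base: "A x \<Longrightarrow> clos A T x"
| step: "clos A T y \<Longrightarrow> clos A T z \<Longrightarrow> T y z x \<Longrightarrow> clos A T x"

text \<open>A ranked set is a record of a derivation: a pair \<open>(j, x)\<close> says that \<open>x\<close> is derived at stage \<open>j\<close> from
  elements of earlier stages. The ranks exclude circular justifications, and they need not be
  compared between different derivations, so that two records can simply be united.\<close>

definition ranked :: "(nat \<Rightarrow> bool) \<Rightarrow> (nat \<Rightarrow> nat \<Rightarrow> nat \<Rightarrow> bool) \<Rightarrow> (nat \<times> nat) set \<Rightarrow> bool" where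
  "ranked A T D \<longleftrightarrow> (\<forall>(j, x)\<in>D. A x \<or>
     (\<exists>y z. T y z x \<and> (\<exists>j'<j. (j', y) \<in> D) \<and> (\<exists>j'<j. (j', z) \<in> D)))"

lemma clos_imp_ranked: "clos A T x \<Longrightarrow> \<exists>D i. finite D \<and> ranked A T D \<and> (i, x) \<in> D"
proof (induction rule: clos.induct)
  case (base x)
  then show ?case by (intro exI[of _ "{(0, x)}"]) (auto simp: ranked_def)
next
  case (step y z x)
  then obtain D i D' i' where D: "finite D" "ranked A T D" "(i, y) \<in> D"
      "finite D'" "ranked A T D'" "(i', z) \<in> D'" by blast
  \<comment> \<open>A rank above those of both premises.\<close>
  let ?i = "Suc (max i i')"
  have lt: "i < ?i" "i' < ?i" by simp_all
  have "ranked A T (insert (?i, x) (D \<union> D'))"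
    unfolding ranked_def
  proof (intro ballI, clarify)
    fix j w assume w: "(j, w) \<in> insert (?i, x) (D \<union> D')"
      and nA: "\<nexists>y z. T y z w \<and> (\<exists>j'<j. (j', y) \<in> insert (?i, x) (D \<union> D')) \<and>
        (\<exists>j'<j. (j', z) \<in> insert (?i, x) (D \<union> D'))"
    from w consider "j = ?i" "w = x" | "(j, w) \<in> D" | "(j, w) \<in> D'" by blast
    then show "A w"
    proof cases
      case 1
      with nA step.hyps(3) D lt show ?thesis by blast
    next
      case 2
      with D(2) nA show ?thesis unfolding ranked_def by blast
    next
      case 3
      with D(5) nA show ?thesis unfolding ranked_def by blast
    qed
  qed
  moreover have "finite (insert (?i, x) (D \<union> D'))" using D by simp
  ultimately show ?case by blast
qed

lemma ranked_imp_clos: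
  assumes "ranked A T D"
  shows "(i, x) \<in> D \<Longrightarrow> clos A T x"
proof (induction i arbitrary: x rule: less_induct)
  case (less i)
  then show ?case using assms unfolding ranked_def by (blast intro: clos.intros)
qed

text \<open>This bounds the quantifiers over the elements of a coded finite set.\<close>

lemma set_decode_less: "x \<in> set_decode c \<Longrightarrow> x < c"
proof -
  assume "x \<in> set_decode c"
  then have "c div 2 ^ x \<noteq> 0" unfolding set_decode_def by (auto intro: ccontr)
  then have "2 ^ x \<le> c" by (simp add: div_eq_0_iff)
  then show ?thesis using less_exp[of x] by linarith
qed

text \<open>A finite derivation is coded as one number, the code of a finite set of codes of pairs. All
  quantifiers after the two leading ones are bounded, except those over the premises of a rule and those inside
  \<open>A\<close> and \<open>T\<close>.\<close>

lemma clos_iff_certificate: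
  "clos A T x \<longleftrightarrow> (\<exists>c i. prod_encode (i, x) \<in> set_decode c \<and>
     (\<forall>j<c. \<forall>y<c. prod_encode (j, y) \<in> set_decode c \<longrightarrow> A y \<or>
       (\<exists>u v. T u v y \<and> (\<exists>j'<j. prod_encode (j', u) \<in> set_decode c) \<and>
          (\<exists>j'<j. prod_encode (j', v) \<in> set_decode c))))"
  (is "_ \<longleftrightarrow> (\<exists>c i. _ \<and> ?cert c)")
proof -
  have cert: "?cert c \<longleftrightarrow> ranked A T {w. prod_encode w \<in> set_decode c}" for c
  proof -
    have "j < c \<and> y < c" if "prod_encode (j, y) \<in> set_decode c" for j y
      using set_decode_less[OF that] le_prod_encode_1[of j y] le_prod_encode_2[of y j] by linarith
    then show ?thesis unfolding ranked_def by auto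
  qed
  show ?thesis
  proof
    assume "clos A T x"
    then obtain D i where D: "finite D" "ranked A T D" "(i, x) \<in> D"
      using clos_imp_ranked by blast
    let ?c = "set_encode (prod_encode ` D)"
    have "{w. prod_encode w \<in> set_decode ?c} = D"
      using D(1) by (auto simp: set_encode_inverse inj_image_mem_iff[OF inj_prod_encode])
    then have "prod_encode (i, x) \<in> set_decode ?c \<and> ?cert ?c"
      unfolding cert using D(2,3) by auto
    then show "\<exists>c i. prod_encode (i, x) \<in> set_decode c \<and> ?cert c" by blast
  next
    assume "\<exists>c i. prod_encode (i, x) \<in> set_decode c \<and> ?cert c"
    then show "clos A T x" unfolding cert using ranked_imp_clos by blast
  qed
qed

text \<open>The order matters: \<open>sigma01_decidable\<close> fits every predicate, so the rules which take a predicate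
  apart come first.\<close>

lemmas sigma01_rules = sigma01_ex sigma01_and sigma01_or sigma01_all_less sigma01_imp sigma01_decidable

text \<open>The rules \<open>A\<close> and \<open>T\<close> may themselves be Sigma-0-1 and may depend on the oracle and on parameters. Thus
  inductive definitions can be layered: formula codes, substitution instances, derivability.\<close>

lemma sigma01_clos:
  assumes A: "sigma01 a (Suc k) (\<lambda>xs b. A (hd xs) (tl xs) b)"
    and T: "sigma01 a (Suc (Suc (Suc k)))
      (\<lambda>xs b. T (hd xs) (hd (tl xs)) (hd (tl (tl xs))) (tl (tl (tl xs))) b)"
    and t: "computable a k t"
  shows "sigma01 a k (\<lambda>xs b. clos (\<lambda>x. A x xs b) (\<lambda>y z x. T y z x xs b) (t xs b))"
proof -
  \<comment> \<open>In the certificate the entries are \<open>v, u, y, j, i, c\<close>, from the innermost to the outermost binder.\<close>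
  have T': "sigma01 a (Suc (Suc (Suc (Suc (Suc (Suc k))))))
     (\<lambda>xs b. T (hd (tl xs)) (hd xs) (hd (tl (tl xs))) (tl (tl (tl (tl (tl (tl xs)))))) b)"
    using sigma01_subst[where ts = "[\<lambda>xs b. hd (tl xs), \<lambda>xs b. hd xs, \<lambda>xs b. hd (tl (tl xs))]"
      and j = "Suc (Suc (Suc (Suc (Suc (Suc 0)))))" and k = k and a = a
      and P = "\<lambda>xs b. T (hd xs) (hd (tl xs)) (hd (tl (tl xs))) (tl (tl (tl xs))) b"] T
    by (simp add: drop_Suc computable_vars)
  have A': "sigma01 a (Suc (Suc (Suc (Suc k)))) (\<lambda>xs b. A (hd xs) (tl (tl (tl (tl xs)))) b)"
    by (rule sigma01_skip)+ (rule A)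
  show ?thesis
    unfolding clos_iff_certificate
    by (rule T' A' computable_tl[OF computable_tl[OF t]] sigma01_rules recursive_rules | simp)+
qed

section \<open>Formulas that bound the size of components\<close>

primrec conj_vars :: "nat \<Rightarrow> form" where
  "conj_vars 0 = Neg Bot"
| "conj_vars (Suc i) = And (conj_vars i) (Var i)"

text \<open>In a frame, \<open>boxes k \<phi>\<close> holds at \<open>x\<close> iff \<open>\<phi>\<close> holds at all points which are reachable from \<open>x\<close> by at
  most \<open>k\<close> steps along the relation or its converse.\<close>

primrec boxes :: "nat \<Rightarrow> form \<Rightarrow> form" where
  "boxes 0 \<phi> = \<phi>"
| "boxes (Suc k) \<phi> = And (boxes k \<phi>) (And (Box0 (boxes k \<phi>)) (Box1 (boxes k \<phi>)))"

primrec tab_disj :: "nat \<Rightarrow> nat \<Rightarrow> form" where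
  "tab_disj m 0 = Bot"
| "tab_disj m (Suc i) = Imp (Neg (tab_disj m i)) (boxes m (Imp (conj_vars i) (Var i)))"

text \<open>The disjunction, for \<open>i\<close> from \<open>0\<close> to \<open>n\<close>, of \<open>boxes n\<close> applied to
  \<open>p\<^sub>0 \<and> \<dots> \<and> p\<^sub>i\<^sub>-\<^sub>1 \<longrightarrow> p\<^sub>i\<close>. If all disjuncts fail at \<open>x\<close>, then for each \<open>i\<close> a point near
  \<open>x\<close> satisfies the variables before \<open>p\<^sub>i\<close> but not \<open>p\<^sub>i\<close>, and these \<open>n + 1\<close> points are distinct.\<close>

definition tab :: "nat \<Rightarrow> form" where
  "tab n = tab_disj n (Suc n)"

text \<open>The recursion adds the modalities outside. Peeling them off inside matches balls in the canonical
  model, which grow at the far end of a path.\<close>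

lemma boxes_Suc_inner: "boxes (Suc k) \<phi> = boxes k (And \<phi> (And (Box0 \<phi>) (Box1 \<phi>)))"
  by (induction k) simp_all

lemma subst_boxes: "subst s (boxes m \<phi>) = boxes m (subst s \<phi>)"
  by (induction m) simp_all

lemma truth_set_conj_vars:
  "x \<in> truth_set F R V (conj_vars i) \<longleftrightarrow> x \<in> F \<and> (\<forall>j<i. x \<in> V j)"
  by (induction i) (auto simp: less_Suc_eq)

lemma truth_set_boxes:
  assumes "truth_set F R V \<phi> = F"
  shows "truth_set F R V (boxes m \<phi>) = F"
  by (induction m) (use assms in auto)

lemma truth_set_tab_disj:
  assumes "x \<in> F"
  shows "x \<in> truth_set F R V (tab_disj m i) \<longleftrightarrow>
    (\<exists>j<i. x \<in> truth_set F R V (boxes m (Imp (conj_vars j) (Var j))))"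
  by (induction i) (use assms in \<open>auto simp: less_Suc_eq simp del: truth_set.simps(1)\<close>)

lemma valid_tab:
  assumes "finite F" "card F \<le> n"
  shows "valid F R (tab n)"
  unfolding valid_def
proof (intro allI impI)
  fix V :: "nat \<Rightarrow> 'a set"
  assume V: "\<forall>p. V p \<subseteq> F"
  let ?\<psi> = "\<lambda>i. Imp (conj_vars i) (Var i)"
  have sub: "truth_set F R V \<phi> \<subseteq> F" for \<phi>
    by (rule truth_set_subset) (use V in blast)
  show "truth_set F R V (tab n) = F"
  proof (rule ccontr)
    assume "truth_set F R V (tab n) \<noteq> F"
    with sub obtain x where x: "x \<in> F" "x \<notin> truth_set F R V (tab n)" by blast
    have "truth_set F R V (?\<psi> i) \<noteq> F" if "i < Suc n" for i
      using x truth_set_boxes[of F R V "?\<psi> i" n] that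
      unfolding tab_def truth_set_tab_disj[OF x(1)] by blast
    then have "\<forall>i\<in>{..<Suc n}. \<exists>y\<in>F. y \<notin> truth_set F R V (?\<psi> i)"
      using sub by blast
    then obtain y where y: "\<And>i. i \<in> {..<Suc n} \<Longrightarrow> y i \<in> F \<and> y i \<notin> truth_set F R V (?\<psi> i)"
      by metis
    have yV: "y i \<notin> V i" "\<forall>j<i. y i \<in> V j" if "i < Suc n" for i
      using y[of i] that by (auto simp: truth_set_conj_vars)
    have "inj_on y {..<Suc n}"
    proof (rule linorder_inj_onI)
      fix i j assume "i < j" "j \<in> {..<Suc n}"
      then show "y i \<noteq> y j" using yV(1)[of i] yV(2)[of j] by auto
    qed auto
    moreover have "y ` {..<Suc n} \<subseteq> F" using y by blast
    ultimately have "card {..<Suc n} \<le> card F" using assms(1) by (rule card_inj_on_le)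
    with assms(2) show False by simp
  qed
qed

lemma tabular_imp_tab:
  assumes "tabular L"
  shows "\<exists>n. tab n \<in> L"
proof -
  obtain F :: "nat set" and R where "finite F" and L: "\<And>\<phi>. \<phi> \<in> L \<longleftrightarrow> valid F R \<phi>"
    using assms by (auto simp: tabular_def)
  then have "tab (card F) \<in> L" by (simp add: valid_tab)
  then show ?thesis ..
qed

lemma tabular_imp_consistent:
  assumes "tabular L"
  shows "Bot \<notin> L"
proof -
  obtain F :: "nat set" and R where "kripke_frame F R" and L: "\<And>\<phi>. \<phi> \<in> L \<longleftrightarrow> valid F R \<phi>"
    using assms by (auto simp: tabular_def)
  then have "F \<noteq> {}" by (simp add: kripke_frame_def)
  moreover have "valid F R Bot \<Longrightarrow> F = {}"
    using validD[of F R Bot "\<lambda>_. {}"] by simp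
  ultimately show ?thesis unfolding L by blast
qed

section \<open>The canonical model\<close>

lemma tense_logic_MP: "tense_logic L \<Longrightarrow> Imp \<phi> \<psi> \<in> L \<Longrightarrow> \<phi> \<in> L \<Longrightarrow> \<psi> \<in> L"
  and tense_logic_nec: "tense_logic L \<Longrightarrow> \<phi> \<in> L \<Longrightarrow> Box0 \<phi> \<in> L" "tense_logic L \<Longrightarrow> \<phi> \<in> L \<Longrightarrow> Box1 \<phi> \<in> L"
  and tense_logic_subst: "tense_logic L \<Longrightarrow> \<phi> \<in> L \<Longrightarrow> subst s \<phi> \<in> L"
  and tense_logic_taut: "tense_logic L \<Longrightarrow> tautology \<phi> \<Longrightarrow> \<phi> \<in> L"
  unfolding tense_logic_def by blast+

lemma tense_logic_axioms:
  assumes "tense_logic L"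
  shows "Imp (Box0 (Imp \<phi> \<psi>)) (Imp (Box0 \<phi>) (Box0 \<psi>)) \<in> L"
    and "Imp (Box1 (Imp \<phi> \<psi>)) (Imp (Box1 \<phi>) (Box1 \<psi>)) \<in> L"
    and "Imp \<phi> (Box0 (Neg (Box1 (Neg \<phi>)))) \<in> L"
    and "Imp \<phi> (Box1 (Neg (Box0 (Neg \<phi>)))) \<in> L"
proof -
  let ?s = "\<lambda>p. if p = 0 then \<phi> else \<psi>"
  have ax: "subst ?s \<alpha> \<in> L" if "\<alpha> \<in> tense_axioms" for \<alpha>
  proof (rule tense_logic_subst[OF assms])
    show "\<alpha> \<in> L" using assms unfolding tense_logic_def by (elim conjE) (erule subsetD, rule that)
  qed
  show "Imp (Box0 (Imp \<phi> \<psi>)) (Imp (Box0 \<phi>) (Box0 \<psi>)) \<in> L"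
    using ax[of "Imp (Box0 (Imp (Var 0) (Var 1))) (Imp (Box0 (Var 0)) (Box0 (Var 1)))"]
    by (simp add: tense_axioms_def Let_def)
  show "Imp (Box1 (Imp \<phi> \<psi>)) (Imp (Box1 \<phi>) (Box1 \<psi>)) \<in> L"
    using ax[of "Imp (Box1 (Imp (Var 0) (Var 1))) (Imp (Box1 (Var 0)) (Box1 (Var 1)))"]
    by (simp add: tense_axioms_def Let_def)
  show "Imp \<phi> (Box0 (Neg (Box1 (Neg \<phi>)))) \<in> L"
    using ax[of "Imp (Var 0) (Box0 (Neg (Box1 (Neg (Var 0)))))"]
    by (simp add: tense_axioms_def Let_def)
  show "Imp \<phi> (Box1 (Neg (Box0 (Neg \<phi>)))) \<in> L"
    using ax[of "Imp (Var 0) (Box1 (Neg (Box0 (Neg (Var 0)))))"]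
    by (simp add: tense_axioms_def Let_def)
qed

text \<open>A theory over \<open>L\<close>: closed under modus ponens, while closure under necessitation and substitution
  is required of logics only.\<close>

definition deductive :: "form set \<Rightarrow> form set \<Rightarrow> bool" where
  "deductive L T \<longleftrightarrow> L \<subseteq> T \<and> (\<forall>\<phi> \<psi>. Imp \<phi> \<psi> \<in> T \<longrightarrow> \<phi> \<in> T \<longrightarrow> \<psi> \<in> T)"

definition mcs :: "form set \<Rightarrow> form set \<Rightarrow> bool" where
  "mcs L \<Gamma> \<longleftrightarrow> deductive L \<Gamma> \<and> Bot \<notin> \<Gamma> \<and> (\<forall>\<phi>. \<phi> \<in> \<Gamma> \<or> Neg \<phi> \<in> \<Gamma>)"

lemma deductive_MP: "deductive L T \<Longrightarrow> Imp \<phi> \<psi> \<in> T \<Longrightarrow> \<phi> \<in> T \<Longrightarrow> \<psi> \<in> T"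
  by (auto simp: deductive_def)

lemma deductive_taut: "tense_logic L \<Longrightarrow> deductive L T \<Longrightarrow> tautology \<phi> \<Longrightarrow> \<phi> \<in> T"
  using tense_logic_taut by (auto simp: deductive_def)

lemma deductive_self: "tense_logic L \<Longrightarrow> deductive L L"
  by (auto simp: deductive_def intro: tense_logic_MP)

text \<open>The deduction theorem, read as a definition: \<open>{\<chi>. Imp \<psi> \<chi> \<in> T}\<close> is the theory generated by \<open>T\<close> and
  \<open>\<psi>\<close>, so no derivations are needed.\<close>

lemma deductive_Imp:
  assumes L: "tense_logic L" and T: "deductive L T"
  shows "deductive L {\<chi>. Imp \<psi> \<chi> \<in> T}" "T \<subseteq> {\<chi>. Imp \<psi> \<chi> \<in> T}" "\<psi> \<in> {\<chi>. Imp \<psi> \<chi> \<in> T}"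
proof -
  have 1: "Imp \<psi> \<chi> \<in> T" if "\<chi> \<in> T" for \<chi>
  proof (rule deductive_MP[OF T _ that])
    show "Imp \<chi> (Imp \<psi> \<chi>) \<in> T" by (rule deductive_taut[OF L T]) (simp add: tautology_def)
  qed
  have 2: "Imp \<psi> \<chi> \<in> T" if "Imp \<psi> (Imp \<theta> \<chi>) \<in> T" "Imp \<psi> \<theta> \<in> T" for \<theta> \<chi>
  proof (rule deductive_MP[OF T _ that(2)], rule deductive_MP[OF T _ that(1)])
    show "Imp (Imp \<psi> (Imp \<theta> \<chi>)) (Imp (Imp \<psi> \<theta>) (Imp \<psi> \<chi>)) \<in> T"
      by (rule deductive_taut[OF L T]) (simp add: tautology_def)
  qed
  show "T \<subseteq> {\<chi>. Imp \<psi> \<chi> \<in> T}" using 1 by blast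
  moreover have "L \<subseteq> T" using T by (simp add: deductive_def)
  ultimately show "deductive L {\<chi>. Imp \<psi> \<chi> \<in> T}" using 2 by (auto simp: deductive_def)
  show "\<psi> \<in> {\<chi>. Imp \<psi> \<chi> \<in> T}"
    using deductive_taut[OF L T, of "Imp \<psi> \<psi>"] by (simp add: tautology_def)
qed

text \<open>A theory which is maximal among those that avoid \<open>\<phi>\<close> is complete: if it lacked both \<open>\<psi>\<close> and
  \<open>Neg \<psi>\<close>, then adding either one would yield \<open>\<phi>\<close>, and \<open>\<phi>\<close> follows from both implications.\<close>

lemma lindenbaum:
  assumes L: "tense_logic L" and T: "deductive L T" and \<phi>: "\<phi> \<notin> T"
  shows "\<exists>\<Gamma>. mcs L \<Gamma> \<and> T \<subseteq> \<Gamma> \<and> \<phi> \<notin> \<Gamma>"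
proof -
  \<comment> \<open>Zorn's lemma is applied to the theories which extend \<open>T\<close> and avoid \<open>\<phi>\<close>.\<close>
  let ?A = "{T'. deductive L T' \<and> T \<subseteq> T' \<and> \<phi> \<notin> T'}"
  have "\<exists>M\<in>?A. \<forall>X\<in>?A. M \<subseteq> X \<longrightarrow> X = M"
  proof (rule subset_Zorn_nonempty)
    show "?A \<noteq> {}" using T \<phi> by auto
  next
    fix \<C> assume "\<C> \<noteq> {}" and chain: "subset.chain ?A \<C>"
    then have C: "\<C> \<subseteq> ?A" "\<And>X Y. X \<in> \<C> \<Longrightarrow> Y \<in> \<C> \<Longrightarrow> X \<subseteq> Y \<or> Y \<subseteq> X"
      by (auto simp: subset_chain_def)
    have MP: "\<psi> \<in> \<Union>\<C>" if imp: "Imp \<chi> \<psi> \<in> \<Union>\<C>" and prem: "\<chi> \<in> \<Union>\<C>" for \<chi> \<psi>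
    proof -
      obtain X Y where X: "X \<in> \<C>" "Imp \<chi> \<psi> \<in> X" and Y: "Y \<in> \<C>" "\<chi> \<in> Y"
        using imp prem by (elim UnionE)
      obtain Z where Z: "Z \<in> \<C>" "X \<subseteq> Z" "Y \<subseteq> Z"
        using C(2)[OF X(1) Y(1)] X(1) Y(1) by auto
      then have "deductive L Z" using C(1) by auto
      then have "\<psi> \<in> Z" using Z X(2) Y(2) by (blast intro: deductive_MP)
      with Z(1) show ?thesis by (rule UnionI)
    qed
    obtain X where X: "X \<in> \<C>" using \<open>\<C> \<noteq> {}\<close> by auto
    with C(1) have "L \<subseteq> X" "T \<subseteq> X" by (auto simp: deductive_def)
    with X have "L \<subseteq> \<Union>\<C>" "T \<subseteq> \<Union>\<C>" by auto
    moreover have "\<phi> \<notin> \<Union>\<C>" using C(1) by auto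
    ultimately show "\<Union>\<C> \<in> ?A" using MP unfolding deductive_def by simp
  qed
  then obtain M where MA: "M \<in> ?A" and maxA: "\<forall>X\<in>?A. M \<subseteq> X \<longrightarrow> X = M" ..
  from MA have M: "deductive L M" "T \<subseteq> M" "\<phi> \<notin> M" by auto
  have max: "X = M" if "deductive L X" "M \<subseteq> X" "\<phi> \<notin> X" for X
    using maxA M(2) that by auto
  have imp: "Imp \<psi> \<phi> \<in> M" if "\<psi> \<notin> M" for \<psi>
    using max[OF deductive_Imp(1,2)[OF L M(1), of \<psi>]] deductive_Imp(3)[OF L M(1), of \<psi>] that by blast
  have "\<psi> \<in> M \<or> Neg \<psi> \<in> M" for \<psi>
  proof (rule ccontr)
    assume "\<not> ?thesis"
    then have imps: "Imp \<psi> \<phi> \<in> M" "Imp (Neg \<psi>) \<phi> \<in> M" by (auto intro: imp)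
    have "Imp (Imp \<psi> \<phi>) (Imp (Imp (Neg \<psi>) \<phi>) \<phi>) \<in> M"
      by (rule deductive_taut[OF L M(1)]) (auto simp: tautology_def)
    from deductive_MP[OF M(1) deductive_MP[OF M(1) this imps(1)] imps(2)] M(3) show False by simp
  qed
  moreover have "Bot \<notin> M"
    using deductive_MP[OF M(1), of Bot \<phi>] deductive_taut[OF L M(1), of "Imp Bot \<phi>"] M(3)
    by (auto simp: tautology_def)
  ultimately have "mcs L M" using M(1) by (simp add: mcs_def)
  with M(2,3) show ?thesis by blast
qed

lemma mcs_sub: "mcs L \<Gamma> \<Longrightarrow> \<phi> \<in> L \<Longrightarrow> \<phi> \<in> \<Gamma>"
  by (auto simp: mcs_def deductive_def)

lemma mcs_Bot: "mcs L \<Gamma> \<Longrightarrow> Bot \<notin> \<Gamma>"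
  by (simp add: mcs_def)

lemma mcs_Imp:
  assumes L: "tense_logic L" and "mcs L \<Gamma>"
  shows "Imp \<phi> \<psi> \<in> \<Gamma> \<longleftrightarrow> (\<phi> \<in> \<Gamma> \<longrightarrow> \<psi> \<in> \<Gamma>)"
proof -
  have T: "deductive L \<Gamma>" and total: "\<phi> \<in> \<Gamma> \<or> Neg \<phi> \<in> \<Gamma>"
    using assms(2) by (auto simp: mcs_def)
  have "Imp \<psi> (Imp \<phi> \<psi>) \<in> \<Gamma>" "Imp (Neg \<phi>) (Imp \<phi> \<psi>) \<in> \<Gamma>"
    by (rule deductive_taut[OF L T]; simp add: tautology_def)+
  with total deductive_MP[OF T, of \<phi> \<psi>] deductive_MP[OF T, of \<psi> "Imp \<phi> \<psi>"]
    deductive_MP[OF T, of "Neg \<phi>" "Imp \<phi> \<psi>"] show ?thesis by blast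
qed

lemma mcs_And:
  assumes L: "tense_logic L" and G: "mcs L \<Gamma>"
  shows "And \<phi> \<psi> \<in> \<Gamma> \<longleftrightarrow> \<phi> \<in> \<Gamma> \<and> \<psi> \<in> \<Gamma>"
proof -
  have "Imp \<phi> (Imp \<psi> (And \<phi> \<psi>)) \<in> \<Gamma>" "Imp (And \<phi> \<psi>) \<phi> \<in> \<Gamma>" "Imp (And \<phi> \<psi>) \<psi> \<in> \<Gamma>"
    by (rule mcs_sub[OF G tense_logic_taut[OF L]]; simp add: tautology_def)+
  then show ?thesis by (auto simp: mcs_Imp[OF assms])
qed

definition canonical :: "(form set \<times> form set) set" where
  "canonical = {(\<Gamma>, \<Delta>). \<forall>\<phi>. Box0 \<phi> \<in> \<Gamma> \<longrightarrow> \<phi> \<in> \<Delta>}"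

text \<open>The two tense axioms express that the canonical relations of the two boxes are converse to each
  other. A failure on one side passes a negated formula through the axiom to the other side.\<close>

lemma canonical_converse:
  assumes L: "tense_logic L" and G: "mcs L \<Gamma>" and D: "mcs L \<Delta>"
  shows "(\<Gamma>, \<Delta>) \<in> canonical \<longleftrightarrow> (\<forall>\<phi>. Box1 \<phi> \<in> \<Delta> \<longrightarrow> \<phi> \<in> \<Gamma>)"
proof -
  note simps = mcs_Imp[OF L G] mcs_Imp[OF L D] mcs_Bot[OF G] mcs_Bot[OF D]
  have dneg: "Imp \<phi> (Neg (Neg \<phi>)) \<in> L" for \<phi>
    by (rule tense_logic_taut[OF L]) (simp add: tautology_def)
  have 0: "Box0 (Neg (Neg \<phi>)) \<in> \<Delta>" if "Box0 \<phi> \<in> \<Delta>" "mcs L \<Delta>" for \<phi> \<Delta>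
    using mcs_sub[OF that(2) tense_logic_MP[OF L tense_logic_axioms(1)[OF L] tense_logic_nec(1)[OF L dneg]], of \<phi>]
      that by (simp add: mcs_Imp[OF L])
  have 1: "Box1 (Neg (Neg \<phi>)) \<in> \<Delta>" if "Box1 \<phi> \<in> \<Delta>" "mcs L \<Delta>" for \<phi> \<Delta>
    using mcs_sub[OF that(2) tense_logic_MP[OF L tense_logic_axioms(2)[OF L] tense_logic_nec(2)[OF L dneg]], of \<phi>]
      that by (simp add: mcs_Imp[OF L])
  show ?thesis
  proof
    assume R: "(\<Gamma>, \<Delta>) \<in> canonical"
    show "\<forall>\<phi>. Box1 \<phi> \<in> \<Delta> \<longrightarrow> \<phi> \<in> \<Gamma>"
    proof (intro allI impI, rule ccontr)
      fix \<phi> assume \<phi>: "Box1 \<phi> \<in> \<Delta>" "\<phi> \<notin> \<Gamma>"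
      then have "Neg \<phi> \<in> \<Gamma>" by (simp add: simps)
      with mcs_sub[OF G tense_logic_axioms(3)[OF L, of "Neg \<phi>"]]
      have "Box0 (Neg (Box1 (Neg (Neg \<phi>)))) \<in> \<Gamma>" by (simp add: simps)
      with R have "Neg (Box1 (Neg (Neg \<phi>))) \<in> \<Delta>" by (simp add: canonical_def)
      with 1[OF \<phi>(1) D] show False by (simp add: simps)
    qed
  next
    assume R: "\<forall>\<phi>. Box1 \<phi> \<in> \<Delta> \<longrightarrow> \<phi> \<in> \<Gamma>"
    show "(\<Gamma>, \<Delta>) \<in> canonical"
      unfolding canonical_def
    proof (clarify, rule ccontr)
      fix \<phi> assume \<phi>: "Box0 \<phi> \<in> \<Gamma>" "\<phi> \<notin> \<Delta>"
      then have "Neg \<phi> \<in> \<Delta>" by (simp add: simps)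
      with mcs_sub[OF D tense_logic_axioms(4)[OF L, of "Neg \<phi>"]]
      have "Box1 (Neg (Box0 (Neg (Neg \<phi>)))) \<in> \<Delta>" by (simp add: simps)
      with R have "Neg (Box0 (Neg (Neg \<phi>))) \<in> \<Gamma>" by simp
      with 0[OF \<phi>(1) G] show False by (simp add: simps)
    qed
  qed
qed

lemma mcs_Box0:
  assumes L: "tense_logic L" and G: "mcs L \<Gamma>"
  shows "Box0 \<phi> \<in> \<Gamma> \<longleftrightarrow> (\<forall>\<Delta>. mcs L \<Delta> \<and> (\<Gamma>, \<Delta>) \<in> canonical \<longrightarrow> \<phi> \<in> \<Delta>)"
proof
  assume *: "\<forall>\<Delta>. mcs L \<Delta> \<and> (\<Gamma>, \<Delta>) \<in> canonical \<longrightarrow> \<phi> \<in> \<Delta>"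
  have "deductive L {\<psi>. Box0 \<psi> \<in> \<Gamma>}"
    unfolding deductive_def
  proof (intro conjI subsetI allI impI CollectI)
    show "Box0 \<psi> \<in> \<Gamma>" if "\<psi> \<in> L" for \<psi>
      by (rule mcs_sub[OF G tense_logic_nec(1)[OF L that]])
    show "Box0 \<psi> \<in> \<Gamma>" if "Imp \<chi> \<psi> \<in> {\<psi>. Box0 \<psi> \<in> \<Gamma>}" "\<chi> \<in> {\<psi>. Box0 \<psi> \<in> \<Gamma>}" for \<chi> \<psi>
      using mcs_sub[OF G tense_logic_axioms(1)[OF L, of \<chi> \<psi>]] that by (simp add: mcs_Imp[OF L G])
  qed
  note ext = lindenbaum[OF L this, of \<phi>]
  show "Box0 \<phi> \<in> \<Gamma>"
  proof (rule ccontr)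
    assume "Box0 \<phi> \<notin> \<Gamma>"
    then obtain \<Delta> where "mcs L \<Delta>" "{\<psi>. Box0 \<psi> \<in> \<Gamma>} \<subseteq> \<Delta>" "\<phi> \<notin> \<Delta>" using ext by auto
    with * show False by (auto simp: canonical_def)
  qed
qed (auto simp: canonical_def)

lemma mcs_Box1:
  assumes L: "tense_logic L" and G: "mcs L \<Gamma>"
  shows "Box1 \<phi> \<in> \<Gamma> \<longleftrightarrow> (\<forall>\<Delta>. mcs L \<Delta> \<and> (\<Delta>, \<Gamma>) \<in> canonical \<longrightarrow> \<phi> \<in> \<Delta>)"
proof
  assume *: "\<forall>\<Delta>. mcs L \<Delta> \<and> (\<Delta>, \<Gamma>) \<in> canonical \<longrightarrow> \<phi> \<in> \<Delta>"
  have "deductive L {\<psi>. Box1 \<psi> \<in> \<Gamma>}"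
    unfolding deductive_def
  proof (intro conjI subsetI allI impI CollectI)
    show "Box1 \<psi> \<in> \<Gamma>" if "\<psi> \<in> L" for \<psi>
      by (rule mcs_sub[OF G tense_logic_nec(2)[OF L that]])
    show "Box1 \<psi> \<in> \<Gamma>" if "Imp \<chi> \<psi> \<in> {\<psi>. Box1 \<psi> \<in> \<Gamma>}" "\<chi> \<in> {\<psi>. Box1 \<psi> \<in> \<Gamma>}" for \<chi> \<psi>
      using mcs_sub[OF G tense_logic_axioms(2)[OF L, of \<chi> \<psi>]] that by (simp add: mcs_Imp[OF L G])
  qed
  note ext = lindenbaum[OF L this, of \<phi>]
  show "Box1 \<phi> \<in> \<Gamma>"
  proof (rule ccontr)
    assume "Box1 \<phi> \<notin> \<Gamma>"
    then obtain \<Delta> where D: "mcs L \<Delta>" and "{\<psi>. Box1 \<psi> \<in> \<Gamma>} \<subseteq> \<Delta>" "\<phi> \<notin> \<Delta>"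
      using ext by auto
    then have "(\<Delta>, \<Gamma>) \<in> canonical" unfolding canonical_converse[OF L D G] by blast
    with * D \<open>\<phi> \<notin> \<Delta>\<close> show False by blast
  qed
next
  assume "Box1 \<phi> \<in> \<Gamma>"
  then show "\<forall>\<Delta>. mcs L \<Delta> \<and> (\<Delta>, \<Gamma>) \<in> canonical \<longrightarrow> \<phi> \<in> \<Delta>"
    using canonical_converse[OF L _ G] by auto
qed

text \<open>Unions of connected components of the canonical model.\<close>

definition canonical_closed :: "form set \<Rightarrow> form set set \<Rightarrow> bool" where
  "canonical_closed L C \<longleftrightarrow> (\<forall>\<Gamma>\<in>C. mcs L \<Gamma> \<and>
     (\<forall>\<Delta>. mcs L \<Delta> \<and> ((\<Gamma>, \<Delta>) \<in> canonical \<or> (\<Delta>, \<Gamma>) \<in> canonical) \<longrightarrow> \<Delta> \<in> C))"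

text \<open>The valuation may interpret the variables by arbitrary formulas \<open>s p\<close>. For \<open>s = Var\<close> this is the usual
  truth lemma; for other \<open>s\<close> it transfers closure under substitution to validity on the frame.\<close>

lemma truth_lemma:
  assumes L: "tense_logic L" and C: "canonical_closed L C" and V: "\<And>p. V p = {\<Gamma>\<in>C. s p \<in> \<Gamma>}"
  shows "truth_set C (canonical \<inter> C \<times> C) V \<phi> = {\<Gamma>\<in>C. subst s \<phi> \<in> \<Gamma>}"
proof -
  have m: "mcs L \<Gamma>" if "\<Gamma> \<in> C" for \<Gamma>
    using C that by (simp add: canonical_closed_def)
  have cl: "\<Delta> \<in> C" if "\<Gamma> \<in> C" "mcs L \<Delta>" "(\<Gamma>, \<Delta>) \<in> canonical \<or> (\<Delta>, \<Gamma>) \<in> canonical" for \<Gamma> \<Delta>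
    using C that unfolding canonical_closed_def by blast
  show ?thesis
  proof (induction \<phi>)
    case Bot
    then show ?case using mcs_Bot[OF m] by simp
  next
    case (And \<phi> \<psi>)
    have "And (subst s \<phi>) (subst s \<psi>) \<in> \<Gamma> \<longleftrightarrow> subst s \<phi> \<in> \<Gamma> \<and> subst s \<psi> \<in> \<Gamma>" if "\<Gamma> \<in> C" for \<Gamma>
      by (rule mcs_And[OF L m[OF that]])
    then show ?case unfolding truth_set.simps subst.simps And.IH by blast
  next
    case (Imp \<phi> \<psi>)
    have "Imp (subst s \<phi>) (subst s \<psi>) \<in> \<Gamma> \<longleftrightarrow> (subst s \<phi> \<in> \<Gamma> \<longrightarrow> subst s \<psi> \<in> \<Gamma>)" if "\<Gamma> \<in> C" for \<Gamma>
      by (rule mcs_Imp[OF L m[OF that]])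
    then show ?case unfolding truth_set.simps subst.simps Imp.IH by blast
  next
    case (Box0 \<phi>)
    have "Box0 (subst s \<phi>) \<in> \<Gamma> \<longleftrightarrow> (\<forall>\<Delta>\<in>C. (\<Gamma>, \<Delta>) \<in> canonical \<longrightarrow> subst s \<phi> \<in> \<Delta>)" if "\<Gamma> \<in> C" for \<Gamma>
      unfolding mcs_Box0[OF L m[OF that]] using m cl[OF that] by blast
    then show ?case unfolding truth_set.simps subst.simps Box0.IH by blast
  next
    case (Box1 \<phi>)
    have "Box1 (subst s \<phi>) \<in> \<Gamma> \<longleftrightarrow> (\<forall>\<Delta>\<in>C. (\<Delta>, \<Gamma>) \<in> canonical \<longrightarrow> subst s \<phi> \<in> \<Delta>)" if "\<Gamma> \<in> C" for \<Gamma>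
      unfolding mcs_Box1[OF L m[OF that]] using m cl[OF that] by blast
    then show ?case unfolding truth_set.simps subst.simps Box1.IH by blast
  qed (simp add: V)
qed

lemma mcs_separate:
  assumes L: "tense_logic L" and "mcs L \<Gamma>" "mcs L \<Delta>" "\<Gamma> \<noteq> \<Delta>"
  shows "\<exists>\<phi>. \<phi> \<in> \<Gamma> \<and> \<phi> \<notin> \<Delta>"
proof (rule ccontr)
  assume "\<nexists>\<phi>. \<phi> \<in> \<Gamma> \<and> \<phi> \<notin> \<Delta>"
  then have sub: "\<Gamma> \<subseteq> \<Delta>" by blast
  have "\<phi> \<in> \<Gamma>" if "\<phi> \<in> \<Delta>" for \<phi>
  proof (rule ccontr)
    assume "\<phi> \<notin> \<Gamma>"
    then have "Neg \<phi> \<in> \<Delta>" using sub mcs_Imp[OF L assms(2), of \<phi> Bot] by blast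
    then show False using that mcs_Imp[OF L assms(3), of \<phi> Bot] mcs_Bot[OF assms(3)] by blast
  qed
  with sub assms(4) show False by blast
qed

text \<open>The formula \<open>\<alpha>\<close> is a conjunction of formulas which separate \<open>\<Gamma>\<close> from the other members of \<open>C\<close> one at a time.\<close>

lemma mcs_isolate:
  assumes L: "tense_logic L" and G: "mcs L \<Gamma>" and "finite C" "\<forall>\<Delta>\<in>C. mcs L \<Delta>"
  shows "\<exists>\<alpha>. \<alpha> \<in> \<Gamma> \<and> (\<forall>\<Delta>\<in>C. \<alpha> \<in> \<Delta> \<longrightarrow> \<Delta> = \<Gamma>)"
  using assms(3,4)
proof (induction C rule: finite_induct)
  case empty
  show ?case using tense_logic_taut[OF L, of "Neg Bot"] mcs_sub[OF G] by (auto simp: tautology_def)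
next
  case (insert \<Delta> C)
  then obtain \<alpha> where \<alpha>: "\<alpha> \<in> \<Gamma>" "\<forall>\<Delta>\<in>C. \<alpha> \<in> \<Delta> \<longrightarrow> \<Delta> = \<Gamma>" by auto
  show ?case
  proof (cases "\<Delta> = \<Gamma>")
    case False
    then obtain \<beta> where \<beta>: "\<beta> \<in> \<Gamma>" "\<beta> \<notin> \<Delta>"
      using mcs_separate[OF L G] insert.prems by (metis insertI1)
    then have "And \<alpha> \<beta> \<in> \<Gamma>" using \<alpha> by (simp add: mcs_And[OF L G])
    moreover have "\<forall>\<Theta>\<in>insert \<Delta> C. And \<alpha> \<beta> \<in> \<Theta> \<longrightarrow> \<Theta> = \<Gamma>"
      using \<alpha>(2) \<beta>(2) insert.prems by (auto simp: mcs_And[OF L])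
    ultimately show ?thesis by blast
  qed (use \<alpha> in blast)
qed

text \<open>The disjunction of the isolating formulas of the elements of \<open>W\<close>.\<close>

lemma mcs_definable:
  assumes L: "tense_logic L" and C: "finite C" "\<forall>\<Delta>\<in>C. mcs L \<Delta>" and W: "W \<subseteq> C"
  shows "\<exists>\<alpha>. W = {\<Delta>\<in>C. \<alpha> \<in> \<Delta>}"
proof -
  have "finite W" using C W finite_subset by blast
  then have "\<exists>\<alpha>. \<forall>\<Delta>\<in>C. \<alpha> \<in> \<Delta> \<longleftrightarrow> \<Delta> \<in> W" using W
  proof (induction W rule: finite_induct)
    case empty
    then show ?case using mcs_Bot C(2) by blast
  next
    case (insert \<Gamma> W)
    then obtain \<beta> where \<beta>: "\<forall>\<Delta>\<in>C. \<beta> \<in> \<Delta> \<longleftrightarrow> \<Delta> \<in> W" by auto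
    obtain \<alpha> where \<alpha>: "\<alpha> \<in> \<Gamma>" "\<forall>\<Delta>\<in>C. \<alpha> \<in> \<Delta> \<longrightarrow> \<Delta> = \<Gamma>"
      using mcs_isolate[OF L _ C] C insert.prems by (metis insert_subset)
    have "\<forall>\<Delta>\<in>C. Imp (Neg \<alpha>) \<beta> \<in> \<Delta> \<longleftrightarrow> \<Delta> \<in> insert \<Gamma> W"
    proof
      fix \<Delta> assume "\<Delta> \<in> C"
      moreover from this C have "mcs L \<Delta>" by blast
      ultimately show "Imp (Neg \<alpha>) \<beta> \<in> \<Delta> \<longleftrightarrow> \<Delta> \<in> insert \<Gamma> W"
        using \<alpha> \<beta> by (auto simp: mcs_Imp[OF L] mcs_Bot)
    qed
    then show ?case by blast
  qed
  then show ?thesis using W by blast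
qed

text \<open>Every valuation on a finite closed set is given by a substitution, since all subsets are definable,
  and the logic contains all substitution instances of \<open>\<phi>\<close>.\<close>

lemma finite_canonical_valid:
  assumes L: "tense_logic L" and C: "canonical_closed L C" and fin: "finite C" and \<phi>: "\<phi> \<in> L"
  shows "valid C (canonical \<inter> C \<times> C) \<phi>"
  unfolding valid_def
proof (intro allI impI)
  fix V :: "nat \<Rightarrow> form set set"
  assume V: "\<forall>p. V p \<subseteq> C"
  have m: "\<forall>\<Delta>\<in>C. mcs L \<Delta>" using C by (simp add: canonical_closed_def)
  have "\<forall>p. \<exists>\<alpha>. V p = {\<Delta>\<in>C. \<alpha> \<in> \<Delta>}"
    using mcs_definable[OF L fin m] V by blast
  then obtain s where "\<And>p. V p = {\<Delta>\<in>C. s p \<in> \<Delta>}" by metis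
  from truth_lemma[OF L C this] show "truth_set C (canonical \<inter> C \<times> C) V \<phi> = C"
    using m mcs_sub[OF _ tense_logic_subst[OF L \<phi>]] by auto
qed

primrec ball :: "form set \<Rightarrow> form set \<Rightarrow> nat \<Rightarrow> form set set" where
  "ball L \<Gamma> 0 = {\<Gamma>}"
| "ball L \<Gamma> (Suc k) = ball L \<Gamma> k \<union>
     {\<Delta>. mcs L \<Delta> \<and> (\<exists>\<Theta>\<in>ball L \<Gamma> k. (\<Theta>, \<Delta>) \<in> canonical \<or> (\<Delta>, \<Theta>) \<in> canonical)}"

lemma ball_mcs: "mcs L \<Gamma> \<Longrightarrow> \<Delta> \<in> ball L \<Gamma> k \<Longrightarrow> mcs L \<Delta>"
  by (induction k arbitrary: \<Delta>) auto

lemma mcs_boxes: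
  assumes L: "tense_logic L" and G: "mcs L \<Gamma>"
  shows "boxes k \<phi> \<in> \<Gamma> \<Longrightarrow> \<Delta> \<in> ball L \<Gamma> k \<Longrightarrow> \<phi> \<in> \<Delta>"
proof (induction k arbitrary: \<phi> \<Delta>)
  case (Suc k)
  have *: "\<phi> \<in> \<Theta> \<and> Box0 \<phi> \<in> \<Theta> \<and> Box1 \<phi> \<in> \<Theta>" if "\<Theta> \<in> ball L \<Gamma> k" for \<Theta>
    using Suc.IH[OF Suc.prems(1)[unfolded boxes_Suc_inner] that]
    by (simp add: mcs_And[OF L ball_mcs[OF G that]])
  show ?case
  proof (cases "\<Delta> \<in> ball L \<Gamma> k")
    case False
    with Suc.prems(2) obtain \<Theta> where "\<Theta> \<in> ball L \<Gamma> k" "mcs L \<Delta>"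
        "(\<Theta>, \<Delta>) \<in> canonical \<or> (\<Delta>, \<Theta>) \<in> canonical" by auto
    with *[of \<Theta>] show ?thesis
      using mcs_Box0[OF L ball_mcs[OF G], of \<Theta> k \<phi>] mcs_Box1[OF L ball_mcs[OF G], of \<Theta> k \<phi>]
      by blast
  qed (use * in blast)
qed simp

lemma mcs_conj_vars:
  assumes L: "tense_logic L" and G: "mcs L \<Gamma>"
  shows "subst s (conj_vars i) \<in> \<Gamma> \<longleftrightarrow> (\<forall>j<i. s j \<in> \<Gamma>)"
  by (induction i) (auto simp: mcs_Imp[OF L G] mcs_And[OF L G] mcs_Bot[OF G] less_Suc_eq)

lemma mcs_tab_disj:
  assumes L: "tense_logic L" and G: "mcs L \<Gamma>"
  shows "subst s (tab_disj m i) \<in> \<Gamma> \<longleftrightarrow>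
    (\<exists>j<i. boxes m (Imp (subst s (conj_vars j)) (s j)) \<in> \<Gamma>)"
  by (induction i) (auto simp: mcs_Imp[OF L G] mcs_Bot[OF G] less_Suc_eq subst_boxes)

text \<open>Take \<open>n + 1\<close> points in the ball and a formula \<open>\<alpha> i\<close> that isolates the \<open>i\<close>-th one among them. Under the
  substitution of \<open>Neg (\<alpha> i)\<close> for the \<open>i\<close>-th variable, the \<open>j\<close>-th point refutes the \<open>j\<close>-th disjunct of
  \<open>tab n\<close>.\<close>

lemma tab_bounds_ball:
  assumes L: "tense_logic L" and G: "mcs L \<Gamma>" and tab: "tab n \<in> L"
    and D: "finite D" "D \<subseteq> ball L \<Gamma> n"
  shows "card D \<le> n"
proof (rule ccontr)
  assume "\<not> card D \<le> n"
  then obtain E where E: "E \<subseteq> D" "card E = Suc n" "finite E"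
    by (metis Suc_leI not_le obtain_subset_with_card_n)
  then obtain e where e: "bij_betw e {..<Suc n} E"
    by (metis ex_bij_betw_nat_finite lessThan_atLeast0)
  have m: "\<forall>\<Delta>\<in>E. mcs L \<Delta>" using ball_mcs[OF G] E(1) D(2) by blast
  have eE: "e i \<in> E" if "i < Suc n" for i using e that by (auto simp: bij_betw_def)
  have "\<forall>i\<in>{..<Suc n}. \<exists>\<alpha>. \<alpha> \<in> e i \<and> (\<forall>\<Delta>\<in>E. \<alpha> \<in> \<Delta> \<longrightarrow> \<Delta> = e i)"
    using mcs_isolate[OF L _ E(3) m] m eE by blast
  then obtain \<alpha> where \<alpha>: "\<And>i. i < Suc n \<Longrightarrow> \<alpha> i \<in> e i"
      "\<And>i \<Delta>. i < Suc n \<Longrightarrow> \<Delta> \<in> E \<Longrightarrow> \<alpha> i \<in> \<Delta> \<Longrightarrow> \<Delta> = e i"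
    by (metis lessThan_iff)
  let ?s = "\<lambda>i. Neg (\<alpha> i)"
  have "subst ?s (tab n) \<in> \<Gamma>" by (rule mcs_sub[OF G tense_logic_subst[OF L tab]])
  then obtain j where j: "j < Suc n" "boxes n (Imp (subst ?s (conj_vars j)) (?s j)) \<in> \<Gamma>"
    unfolding tab_def mcs_tab_disj[OF L G] by blast
  have mj: "mcs L (e j)" using m eE[OF j(1)] by blast
  have "Imp (subst ?s (conj_vars j)) (?s j) \<in> e j"
    by (rule mcs_boxes[OF L G j(2)]) (use eE[OF j(1)] E D in blast)
  moreover have "?s j \<notin> e j"
    using \<alpha>(1)[OF j(1)] by (simp add: mcs_Imp[OF L mj] mcs_Bot[OF mj])
  moreover have "?s i \<in> e j" if "i < j" for i
  proof -
    have "e i \<noteq> e j"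
      using inj_onD[OF bij_betw_imp_inj_on[OF e], of i j] that j(1) by auto
    then have "\<alpha> i \<notin> e j" using \<alpha>(2)[of i "e j"] that j(1) eE[OF j(1)] by auto
    then show ?thesis by (simp add: mcs_Imp[OF L mj])
  qed
  ultimately show False by (simp add: mcs_Imp[OF L mj] mcs_conj_vars[OF L mj])
qed

text \<open>Starting from \<open>{\<Gamma>}\<close>, add neighbours one by one. After \<open>k\<close> additions the set lies in the ball of
  radius \<open>k\<close> and has \<open>k + 1\<close> points, unless it has become closed before; \<open>n\<close> additions are
  impossible.\<close>

lemma tab_imp_small_component:
  assumes L: "tense_logic L" and G: "mcs L \<Gamma>" and tab: "tab n \<in> L"
  shows "\<exists>C. finite C \<and> card C \<le> n \<and> \<Gamma> \<in> C \<and> canonical_closed L C"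
proof -
  have "(\<exists>C. finite C \<and> C \<subseteq> ball L \<Gamma> k \<and> \<Gamma> \<in> C \<and> canonical_closed L C) \<or>
      (\<exists>D. finite D \<and> D \<subseteq> ball L \<Gamma> k \<and> \<Gamma> \<in> D \<and> card D = Suc k)" for k
  proof (induction k)
    case 0
    show ?case by (rule disjI2, rule exI[of _ "{\<Gamma>}"]) simp
  next
    case (Suc k)
    then consider (closed) C where "finite C" "C \<subseteq> ball L \<Gamma> k" "\<Gamma> \<in> C" "canonical_closed L C"
      | (large) D where "finite D" "D \<subseteq> ball L \<Gamma> k" "\<Gamma> \<in> D" "card D = Suc k" "\<not> canonical_closed L D"
      by blast
    then show ?case
    proof cases
      case closed
      then show ?thesis by auto
    next
      case large
      from large(2) ball_mcs[OF G] have m: "\<forall>\<Delta>\<in>D. mcs L \<Delta>" by blast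
      with large(5) obtain \<Theta> \<Delta> where T: "\<Theta> \<in> D" "mcs L \<Delta>"
          "(\<Theta>, \<Delta>) \<in> canonical \<or> (\<Delta>, \<Theta>) \<in> canonical" and new: "\<Delta> \<notin> D"
        unfolding canonical_closed_def by blast
      from T large(2) have "\<Delta> \<in> ball L \<Gamma> (Suc k)" by auto
      with large new have "finite (insert \<Delta> D) \<and> insert \<Delta> D \<subseteq> ball L \<Gamma> (Suc k) \<and>
          \<Gamma> \<in> insert \<Delta> D \<and> card (insert \<Delta> D) = Suc (Suc k)"
        by auto
      then show ?thesis by blast
    qed
  qed
  from this[of n] show ?thesis using tab_bounds_ball[OF L G tab] by (metis Suc_n_not_le_n)
qed

section \<open>Disjoint unions and the criterion for tabularity\<close>

definition union_rel :: "'i set \<Rightarrow> ('i \<Rightarrow> ('w \<times> 'w) set) \<Rightarrow> (('i \<times> 'w) \<times> ('i \<times> 'w)) set" where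
  "union_rel I R = {((i, x), (j, y)). i \<in> I \<and> i = j \<and> (x, y) \<in> R i}"

lemma truth_set_union:
  "truth_set (Sigma I F) (union_rel I R) V \<phi> =
    Sigma I (\<lambda>i. truth_set (F i) (R i) (\<lambda>p. {x. (i, x) \<in> V p}) \<phi>)"
  if "\<And>p. V p \<subseteq> Sigma I F"
proof (induction \<phi>)
  case (Var p)
  then show ?case using that[of p] by auto
qed (auto simp: union_rel_def)

lemma valid_union:
  "valid (Sigma I F) (union_rel I R) \<phi> \<longleftrightarrow> (\<forall>i\<in>I. valid (F i) (R i) \<phi>)"
proof
  assume *: "valid (Sigma I F) (union_rel I R) \<phi>"
  show "\<forall>i\<in>I. valid (F i) (R i) \<phi>"
    unfolding valid_def
  proof (intro ballI allI impI)
    fix i and V :: "nat \<Rightarrow> 'b set" assume i: "i \<in> I" and V: "\<forall>p. V p \<subseteq> F i"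
    let ?V = "\<lambda>p. {i} \<times> V p"
    have sub: "?V p \<subseteq> Sigma I F" for p using V i by auto
    have "Sigma I (\<lambda>j. truth_set (F j) (R j) (\<lambda>p. {x. (j, x) \<in> ?V p}) \<phi>) = Sigma I F"
      by (rule trans[OF truth_set_union[symmetric, where V = ?V, OF sub] validD[OF *, where V = ?V, OF sub]])
    from arg_cong[OF this, of "\<lambda>S. S `` {i}"] i
    have "truth_set (F i) (R i) (\<lambda>p. {x. (i, x) \<in> ?V p}) \<phi> = F i"
      by (simp add: Sigma_Image)
    then show "truth_set (F i) (R i) V \<phi> = F i" by simp
  qed
next
  assume *: "\<forall>i\<in>I. valid (F i) (R i) \<phi>"
  show "valid (Sigma I F) (union_rel I R) \<phi>"
    unfolding valid_def
  proof (intro allI impI)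
    fix V :: "nat \<Rightarrow> ('a \<times> 'b) set" assume V: "\<forall>p. V p \<subseteq> Sigma I F"
    have "truth_set (F i) (R i) (\<lambda>p. {x. (i, x) \<in> V p}) \<phi> = F i" if "i \<in> I" for i
      by (rule validD) (use * that V in auto)
    then have "Sigma I (\<lambda>i. truth_set (F i) (R i) (\<lambda>p. {x. (i, x) \<in> V p}) \<phi>) = Sigma I F"
      by (rule Sigma_cong[OF refl])
    then show "truth_set (Sigma I F) (union_rel I R) V \<phi> = Sigma I F"
      using truth_set_union[of V I F R \<phi>] V by simp
  qed
qed

lemma subst_Var: "subst Var \<phi> = \<phi>"
  by (induction \<phi>) simp_all

text \<open>Since the size of the component is at most \<open>n\<close>, it can be copied to a frame on the numbers below \<open>n\<close>; such
  frames form a finite set.\<close>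

lemma tab_refutation:
  assumes L: "tense_logic L" and tab: "tab n \<in> L" and \<phi>: "\<phi> \<notin> L"
  shows "\<exists>F R. kripke_frame F R \<and> F \<subseteq> {..<n} \<and> (\<forall>\<psi>\<in>L. valid F R \<psi>) \<and> \<not> valid F R \<phi>"
proof -
  obtain \<Gamma> where G: "mcs L \<Gamma>" "\<phi> \<notin> \<Gamma>"
    using lindenbaum[OF L deductive_self[OF L] \<phi>] by blast
  obtain C where C: "finite C" "card C \<le> n" "\<Gamma> \<in> C" "canonical_closed L C"
    using tab_imp_small_component[OF L G(1) tab] by blast
  let ?R = "canonical \<inter> C \<times> C"
  have "truth_set C ?R (\<lambda>p. {\<Gamma>\<in>C. Var p \<in> \<Gamma>}) \<phi> = {\<Gamma>\<in>C. \<phi> \<in> \<Gamma>}"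
    using truth_lemma[OF L C(4), where s = Var] by (simp add: subst_Var)
  with G(2) C(3) have nv: "\<not> valid C ?R \<phi>"
    unfolding valid_def by (auto intro!: exI[of _ "\<lambda>p. {\<Gamma>\<in>C. Var p \<in> \<Gamma>}"])
  obtain h :: "form set \<Rightarrow> nat" and k where h: "h ` C = {i. i < k}" "inj_on h C"
    using finite_imp_inj_to_nat_seg[OF C(1)] by blast
  then have "k = card C" using card_image[of h C] by simp
  with C(2) h have sub: "h ` C \<subseteq> {..<n}" by auto
  have "kripke_frame (h ` C) (map_prod h h ` ?R)"
    using C(3) by (fastforce simp: kripke_frame_def)
  moreover have "valid (h ` C) (map_prod h h ` ?R) \<psi> \<longleftrightarrow> valid C ?R \<psi>" for \<psi>
    by (rule valid_image[OF h(2)]) blast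
  ultimately show ?thesis
    using nv sub finite_canonical_valid[OF L C(4,1)] by blast
qed

text \<open>For the converse direction, the characterizing frame is the disjoint union of all frames on numbers
  below \<open>n\<close> that validate \<open>L\<close>. The family is nonempty because \<open>Bot\<close> is refuted on one of its members.\<close>

theorem tabular_iff_tab:
  assumes L: "tense_logic L"
  shows "tabular L \<longleftrightarrow> Bot \<notin> L \<and> (\<exists>n. tab n \<in> L)"
proof
  assume "Bot \<notin> L \<and> (\<exists>n. tab n \<in> L)"
  then obtain n where Bot: "Bot \<notin> L" and tab: "tab n \<in> L" by blast
  \<comment> \<open>Each frame in the family serves as its own index.\<close>
  let ?I = "{(F, R). kripke_frame F R \<and> F \<subseteq> {..<n} \<and> (\<forall>\<psi>\<in>L. valid F R \<psi>)}"
  have "?I \<subseteq> Pow {..<n} \<times> Pow ({..<n} \<times> {..<n})"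
    by (auto simp: kripke_frame_def)
  then have fin: "finite ?I" by (rule finite_subset) simp
  have ne: "?I \<noteq> {}" using tab_refutation[OF L tab Bot] by blast
  show "tabular L"
  proof (rule tabularI[OF L, of "Sigma ?I fst" "union_rel ?I snd"])
    show "kripke_frame (Sigma ?I fst) (union_rel ?I snd)"
    proof (rule iffD2[OF kripke_frame_def], rule conjI)
      obtain F R where FR: "(F, R) \<in> ?I" using ne by auto
      then obtain x where "x \<in> F" by (auto simp: kripke_frame_def)
      with FR have "((F, R), x) \<in> Sigma ?I fst" by simp
      then show "Sigma ?I fst \<noteq> {}" by (metis empty_iff)
      show "union_rel ?I snd \<subseteq> Sigma ?I fst \<times> Sigma ?I fst"
        by (auto simp: union_rel_def kripke_frame_def)
    qed
    show "finite (Sigma ?I fst)"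
    proof (rule finite_SigmaI[OF fin])
      fix i assume "i \<in> ?I"
      then have "fst i \<subseteq> {..<n}" by auto
      then show "finite (fst i)" by (rule finite_subset) (rule finite_lessThan)
    qed
    show "\<phi> \<in> L \<longleftrightarrow> valid (Sigma ?I fst) (union_rel ?I snd) \<phi>" for \<phi>
      using tab_refutation[OF L tab, of \<phi>] by (auto simp: valid_union)
  qed
qed (simp add: tabular_imp_tab tabular_imp_consistent)

section \<open>Arithmetization of syntax and derivability\<close>

lemma clos_range_gcode:
  "clos (\<lambda>x. (\<exists>p. x = prod_encode (0, p)) \<or> x = prod_encode (1, 0))
     (\<lambda>y z x. x = prod_encode (2, prod_encode (y, z)) \<or> x = prod_encode (3, prod_encode (y, z)) \<or>
       x = prod_encode (4, y) \<or> x = prod_encode (5, y)) x \<longleftrightarrow> x \<in> range gcode"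
  (is "clos ?A ?T x \<longleftrightarrow> _")
proof
  assume "clos ?A ?T x"
  then have "\<exists>\<phi>. x = gcode \<phi>"
  proof (induction rule: clos.induct)
    case (base x)
    then show ?case by (metis gcode.simps(1,2))
  next
    case (step y z x)
    then show ?case by (metis gcode.simps(3-6))
  qed
  then show "x \<in> range gcode" by blast
next
  have "clos ?A ?T (gcode \<phi>)" for \<phi>
  proof (induction \<phi>)
    case (And \<phi> \<psi>)
    then show ?case by (rule clos.step) simp
  next
    case (Imp \<phi> \<psi>)
    then show ?case by (rule clos.step) simp
  next
    case (Box0 \<phi>)
    from this this show ?case by (rule clos.step) simp
  next
    case (Box1 \<phi>)
    from this this show ?case by (rule clos.step) simp
  qed (auto intro: clos.base)
  then show "x \<in> range gcode \<Longrightarrow> clos ?A ?T x" by blast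
qed

lemma sigma01_range_gcode:
  "computable a k t \<Longrightarrow> sigma01 a k (\<lambda>xs b. t xs b \<in> range gcode)"
  unfolding clos_range_gcode[symmetric]
  by (rule sigma01_clos; (rule sigma01_rules recursive_rules | assumption | simp)+)

text \<open>A number coding a finite set of pairs serves as a finite table for a substitution. Taking the least
  second component makes the table single-valued whatever the set is.\<close>

definition looked_up :: "nat \<Rightarrow> nat \<Rightarrow> nat \<Rightarrow> bool" where
  "looked_up s p d \<longleftrightarrow> prod_encode (p, d) \<in> set_decode s \<and>
     (\<forall>d'<d. prod_encode (p, d') \<notin> set_decode s)"

lemma looked_up_unique: "looked_up s p d \<Longrightarrow> (LEAST d. prod_encode (p, d) \<in> set_decode s) = d"
  unfolding looked_up_def by (intro Least_equality) (auto intro: leI)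

text \<open>The inductive definition with rules \<open>subst_base n\<close> and \<open>subst_step\<close> generates the pairs of codes of \<open>\<phi>\<close>
  and \<open>subst s \<phi>\<close>, where \<open>s\<close> is read off from the table \<open>n\<close>. The lookup result has to be checked to be a
  formula code.\<close>

abbreviation subst_base :: "nat \<Rightarrow> nat \<Rightarrow> bool" where
  "subst_base s w \<equiv>
     (\<exists>p d. w = prod_encode (prod_encode (0, p), d) \<and> looked_up s p d \<and> d \<in> range gcode) \<or>
     w = prod_encode (prod_encode (1, 0), prod_encode (1, 0))"

abbreviation subst_step :: "nat \<Rightarrow> nat \<Rightarrow> nat \<Rightarrow> bool" where
  "subst_step u v w \<equiv>
     \<exists>c d c' d'. u = prod_encode (c, d) \<and> v = prod_encode (c', d') \<and>
       (w = prod_encode (prod_encode (2, prod_encode (c, c')), prod_encode (2, prod_encode (d, d'))) \<or>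
        w = prod_encode (prod_encode (3, prod_encode (c, c')), prod_encode (3, prod_encode (d, d'))) \<or>
        w = prod_encode (prod_encode (4, c), prod_encode (4, d)) \<or>
        w = prod_encode (prod_encode (5, c), prod_encode (5, d)))"

lemma clos_subst_sound:
  "clos (subst_base n) subst_step w \<Longrightarrow> \<exists>\<phi> s. w = prod_encode (gcode \<phi>, gcode (subst s \<phi>))"
proof -
  define s where "s p = inv gcode (LEAST d. prod_encode (p, d) \<in> set_decode n)" for p
  assume "clos (subst_base n) subst_step w"
  then have "\<exists>\<phi>. w = prod_encode (gcode \<phi>, gcode (subst s \<phi>))"
  proof (induction rule: clos.induct)
    case (base w)
    then show ?case
    proof
      assume "\<exists>p d. w = prod_encode (prod_encode (0, p), d) \<and> looked_up n p d \<and> d \<in> range gcode"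
      then obtain p d where w: "w = prod_encode (prod_encode (0, p), d)"
        and d: "looked_up n p d" "d \<in> range gcode" by blast
      have "gcode (s p) = d"
        unfolding s_def looked_up_unique[OF d(1)] using d(2) by (rule f_inv_into_f)
      with w show ?thesis by (intro exI[of _ "Var p"]) simp
    qed (intro exI[of _ Bot], simp)
  next
    case (step u v w)
    from step.IH obtain \<phi> \<psi> where uv: "u = prod_encode (gcode \<phi>, gcode (subst s \<phi>))"
      "v = prod_encode (gcode \<psi>, gcode (subst s \<psi>))" by blast
    from step.hyps(3) uv have "w \<in> (\<lambda>\<phi>. prod_encode (gcode \<phi>, gcode (subst s \<phi>))) `
        {And \<phi> \<psi>, Imp \<phi> \<psi>, Box0 \<phi>, Box1 \<phi>}"
      by auto
    then show ?case by blast
  qed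
  then show ?thesis by blast
qed

text \<open>A formula has finitely many variables, so a sufficiently long finite part of \<open>s\<close> is a table for it.
  The inductive proof produces the length \<open>N\<close> along the way.\<close>

lemma clos_subst_complete:
  "\<exists>n. clos (subst_base n) subst_step (prod_encode (gcode \<phi>, gcode (subst s \<phi>)))"
proof -
  have "\<exists>N. \<forall>n. (\<forall>p<N. looked_up n p (gcode (s p))) \<longrightarrow>
      clos (subst_base n) subst_step (prod_encode (gcode \<phi>, gcode (subst s \<phi>)))"
  proof (induction \<phi>)
    case (Var p)
    show ?case by (intro exI[of _ "Suc p"] allI impI clos.base) auto
  next
    case Bot
    show ?case by (intro exI[of _ 0] allI impI clos.base) auto
  next
    case (And \<phi> \<psi>)
    then obtain N M where
      N: "\<And>n. (\<forall>p<N. looked_up n p (gcode (s p))) \<Longrightarrow>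
        clos (subst_base n) subst_step (prod_encode (gcode \<phi>, gcode (subst s \<phi>)))"
      and M: "\<And>n. (\<forall>p<M. looked_up n p (gcode (s p))) \<Longrightarrow>
        clos (subst_base n) subst_step (prod_encode (gcode \<psi>, gcode (subst s \<psi>)))" by auto
    show ?case by (intro exI[of _ "max N M"] allI impI, rule clos.step[OF N M]) auto
  next
    case (Imp \<phi> \<psi>)
    then obtain N M where
      N: "\<And>n. (\<forall>p<N. looked_up n p (gcode (s p))) \<Longrightarrow>
        clos (subst_base n) subst_step (prod_encode (gcode \<phi>, gcode (subst s \<phi>)))"
      and M: "\<And>n. (\<forall>p<M. looked_up n p (gcode (s p))) \<Longrightarrow>
        clos (subst_base n) subst_step (prod_encode (gcode \<psi>, gcode (subst s \<psi>)))" by auto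
    show ?case by (intro exI[of _ "max N M"] allI impI, rule clos.step[OF N M]) auto
  next
    case (Box0 \<phi>)
    then obtain N where
      N: "\<And>n. (\<forall>p<N. looked_up n p (gcode (s p))) \<Longrightarrow>
        clos (subst_base n) subst_step (prod_encode (gcode \<phi>, gcode (subst s \<phi>)))" by auto
    show ?case by (intro exI[of _ N] allI impI, rule clos.step[OF N N]) auto
  next
    case (Box1 \<phi>)
    then obtain N where
      N: "\<And>n. (\<forall>p<N. looked_up n p (gcode (s p))) \<Longrightarrow>
        clos (subst_base n) subst_step (prod_encode (gcode \<phi>, gcode (subst s \<phi>)))" by auto
    show ?case by (intro exI[of _ N] allI impI, rule clos.step[OF N N]) auto
  qed
  then obtain N where N: "\<And>n. (\<forall>p<N. looked_up n p (gcode (s p))) \<Longrightarrow>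
      clos (subst_base n) subst_step (prod_encode (gcode \<phi>, gcode (subst s \<phi>)))" by blast
  have "looked_up (set_encode ((\<lambda>p. prod_encode (p, gcode (s p))) ` {..<N})) p (gcode (s p))"
    if "p < N" for p
    using that by (auto simp: looked_up_def set_encode_inverse)
  then show ?thesis using N by blast
qed

lemma sigma01_subst_instance:
  assumes "computable a k t" "computable a k u"
  shows "sigma01 a k (\<lambda>xs b. \<exists>\<phi> s. t xs b = gcode \<phi> \<and> u xs b = gcode (subst s \<phi>))"
proof -
  have eq: "(\<exists>\<phi> s. c = gcode \<phi> \<and> d = gcode (subst s \<phi>)) \<longleftrightarrow>
      (\<exists>n. clos (subst_base n) subst_step (prod_encode (c, d)))" for c d
    using clos_subst_sound[of _ "prod_encode (c, d)"] clos_subst_complete by fastforce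
  show ?thesis
    unfolding eq looked_up_def
    by (rule sigma01_ex, rule sigma01_clos;
        (rule sigma01_rules sigma01_range_gcode recursive_rules assms[THEN computable_tl] | simp)+)
qed

text \<open>Tautologies and axioms are not among the rules, as the sets \<open>\<Gamma>\<close> of interest contain a tense logic.\<close>

inductive_set generated :: "form set \<Rightarrow> form set" for \<Gamma> where
  base: "\<phi> \<in> \<Gamma> \<Longrightarrow> \<phi> \<in> generated \<Gamma>"
| MP: "\<phi> \<in> generated \<Gamma> \<Longrightarrow> Imp \<phi> \<psi> \<in> generated \<Gamma> \<Longrightarrow> \<psi> \<in> generated \<Gamma>"
| nec0: "\<phi> \<in> generated \<Gamma> \<Longrightarrow> Box0 \<phi> \<in> generated \<Gamma>"
| nec1: "\<phi> \<in> generated \<Gamma> \<Longrightarrow> Box1 \<phi> \<in> generated \<Gamma>"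
| subst: "\<phi> \<in> generated \<Gamma> \<Longrightarrow> subst s \<phi> \<in> generated \<Gamma>"

text \<open>The condition \<open>x \<in> range gcode\<close> makes it unnecessary to invert the code of an implication.\<close>

abbreviation generated_step :: "nat \<Rightarrow> nat \<Rightarrow> nat \<Rightarrow> bool" where
  "generated_step y z x \<equiv> (z = prod_encode (3, prod_encode (y, x)) \<and> x \<in> range gcode) \<or>
     x = prod_encode (4, y) \<or> x = prod_encode (5, y) \<or>
     (\<exists>\<phi> s. y = gcode \<phi> \<and> x = gcode (subst s \<phi>))"

lemma gcode_inject [simp]: "gcode \<phi> = gcode \<psi> \<longleftrightarrow> \<phi> = \<psi>"
  using inj_gcode by (auto dest: injD)

lemma clos_generated:
  "clos (\<lambda>x. x \<in> range gcode \<and> G x) generated_step x \<longleftrightarrow> x \<in> gcode ` generated {\<phi>. G (gcode \<phi>)}"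
  (is "clos ?A _ _ \<longleftrightarrow> _ \<in> gcode ` ?L")
proof
  assume "clos ?A generated_step x"
  then show "x \<in> gcode ` ?L"
  proof (induction rule: clos.induct)
    case (base x)
    then show ?case by (auto intro: generated.base)
  next
    case (step y z x)
    then obtain \<phi> \<psi> where \<phi>: "y = gcode \<phi>" "\<phi> \<in> ?L" and \<psi>: "z = gcode \<psi>" "\<psi> \<in> ?L" by auto
    from step.hyps(3) consider (MP) \<chi> where "z = gcode (Imp \<phi> \<chi>)" "x = gcode \<chi>"
      | (nec0) "x = gcode (Box0 \<phi>)" | (nec1) "x = gcode (Box1 \<phi>)"
      | (subst) s where "x = gcode (subst s \<phi>)"
      using \<phi>(1) by auto
    then show ?case
    proof cases
      case MP
      then have "\<psi> = Imp \<phi> \<chi>" using \<psi>(1) by (simp del: gcode.simps)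
      then show ?thesis using MP(2) \<phi>(2) \<psi>(2) by (auto intro: generated.MP)
    qed (use \<phi>(2) in \<open>auto intro: generated.intros simp del: gcode.simps\<close>)
  qed
next
  have "clos ?A generated_step (gcode \<phi>)" if "\<phi> \<in> ?L" for \<phi>
    using that
  proof (induction rule: generated.induct)
    case (base \<phi>)
    then show ?case by (auto intro: clos.base)
  next
    case (MP \<phi> \<psi>)
    from MP.IH show ?case by (rule clos.step) simp
  next
    case (nec0 \<phi>)
    from nec0.IH nec0.IH show ?case by (rule clos.step) simp
  next
    case (nec1 \<phi>)
    from nec1.IH nec1.IH show ?case by (rule clos.step) simp
  next
    case (subst \<phi> s)
    from subst.IH subst.IH show ?case by (rule clos.step) auto
  qed
  then show "x \<in> gcode ` ?L \<Longrightarrow> clos ?A generated_step x" by blast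
qed

lemma sigma01_generated:
  assumes G: "decidable a (Suc k) (\<lambda>xs b. G (hd xs) (tl xs) b)" and t: "computable a k t"
  shows "sigma01 a k (\<lambda>xs b. t xs b \<in> gcode ` generated {\<phi>. G (gcode \<phi>) xs b})"
proof -
  have "sigma01 a k (\<lambda>xs b. clos (\<lambda>x. x \<in> range gcode \<and> G x xs b) generated_step (t xs b))"
    by (rule sigma01_clos;
        (rule G t sigma01_subst_instance sigma01_range_gcode sigma01_rules recursive_rules | simp)+)
  then show ?thesis by (simp only: clos_generated)
qed

lemma gcode_boxes:
  "gcode (boxes m \<phi>) = rec_nat (gcode \<phi>) (\<lambda>_ r. prod_encode (2, prod_encode (r,
     prod_encode (2, prod_encode (prod_encode (4, r), prod_encode (5, r)))))) m"
  by (induction m) simp_all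

lemma gcode_conj_vars:
  "gcode (conj_vars i) = rec_nat (gcode (Neg Bot)) (\<lambda>i r.
     prod_encode (2, prod_encode (r, prod_encode (0, i)))) i"
  by (induction i) simp_all

lemma gcode_tab_disj:
  "gcode (tab_disj m i) = rec_nat (gcode Bot) (\<lambda>i r.
     prod_encode (3, prod_encode (prod_encode (3, prod_encode (r, gcode Bot)),
       gcode (boxes m (Imp (conj_vars i) (Var i)))))) i"
  by (induction i) simp_all

lemma computable_gcode_tab:
  assumes t: "computable a k t"
  shows "computable a k (\<lambda>xs b. gcode (tab (t xs b)))"
proof -
  have conj: "computable a k (\<lambda>xs b. gcode (conj_vars (t xs b)))" if "computable a k t" for k t
    unfolding gcode_conj_vars
    by (rule computable_rec recursive_rules that | simp)+
  have boxes: "computable a k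
      (\<lambda>xs b. gcode (boxes (t xs b) (Imp (conj_vars (u xs b)) (Var (u xs b)))))"
    if "computable a k t" "computable a k u" for k t u
    unfolding gcode_boxes gcode.simps(1,4)
    by (rule computable_rec conj recursive_rules that | simp)+
  show ?thesis
    unfolding tab_def gcode_tab_disj
    by (rule computable_rec boxes recursive_rules t computable_tl[OF computable_tl[OF t]] | simp)+
qed

section \<open>Pretabular extensions\<close>

lemma tense_logic_generated:
  assumes L: "tense_logic L" "L \<subseteq> \<Gamma>"
  shows "tense_logic (generated \<Gamma>)"
proof -
  have sub: "L \<subseteq> generated \<Gamma>" using L(2) by (auto intro: generated.base)
  have "{\<phi>. tautology \<phi>} \<subseteq> generated \<Gamma>" using tense_logic_taut[OF L(1)] sub by auto
  moreover have "tense_axioms \<subseteq> generated \<Gamma>"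
    using L(1) sub unfolding tense_logic_def by (elim conjE) (erule subset_trans)
  ultimately show ?thesis
    unfolding tense_logic_def
    by (intro conjI allI impI) (auto intro: generated.MP generated.nec0 generated.nec1 generated.subst)
qed

lemma generated_least:
  assumes L: "tense_logic L" "\<Gamma> \<subseteq> L"
  shows "generated \<Gamma> \<subseteq> L"
proof
  fix \<phi> assume "\<phi> \<in> generated \<Gamma>"
  then show "\<phi> \<in> L"
  proof (induction rule: generated.induct)
    case (base \<phi>)
    then show ?case using L(2) by blast
  next
    case (MP \<phi> \<psi>)
    from tense_logic_MP[OF L(1) MP.IH(2,1)] show ?case .
  next
    case (nec0 \<phi>)
    from tense_logic_nec(1)[OF L(1) nec0.IH] show ?case .
  next
    case (nec1 \<phi>)
    from tense_logic_nec(2)[OF L(1) nec1.IH] show ?case .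
  next
    case (subst \<phi> s)
    from tense_logic_subst[OF L(1) subst.IH] show ?case .
  qed
qed

lemma consistent_iff_Bot:
  assumes "tense_logic L"
  shows "consistent L \<longleftrightarrow> Bot \<notin> L"
proof -
  have "\<phi> \<in> L" if "Bot \<in> L" for \<phi>
    using tense_logic_MP[OF assms tense_logic_taut[OF assms, of "Imp Bot \<phi>"] that]
    by (simp add: tautology_def)
  then show ?thesis unfolding consistent_def by auto
qed

text \<open>It suffices to test the extensions by a single formula: every proper extension includes one of them,
  and containing \<open>tab n\<close> is inherited by larger sets. If \<open>L'\<close> is inconsistent, the last condition
  is void, in accordance with the fact that it has no proper extensions.\<close>

lemma PTAB_iff:
  assumes L: "tense_logic L"
  shows "L' \<in> PTAB L \<longleftrightarrow> L \<subseteq> L' \<and> generated L' \<subseteq> L' \<and> (Bot \<in> L' \<or> (\<forall>n. tab n \<notin> L')) \<and>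
    (\<forall>\<phi>. \<phi> \<in> L' \<or> (\<exists>n. tab n \<in> generated (insert \<phi> L')))"
    (is "_ \<longleftrightarrow> ?rhs")
proof
  assume "L' \<in> PTAB L"
  then have sub: "L \<subseteq> L'" and L': "tense_logic L'" and nt: "\<not> tabular L'"
    and ext: "\<And>L''. proper_extension L' L'' \<Longrightarrow> consistent L'' \<Longrightarrow> tabular L''"
    by (auto simp: PTAB_def extension_def pretabular_def)
  have "\<exists>n. tab n \<in> generated (insert \<phi> L')" if \<phi>: "\<phi> \<notin> L'" for \<phi>
  proof -
    let ?E = "generated (insert \<phi> L')"
    have E: "tense_logic ?E" by (rule tense_logic_generated[OF L']) auto
    have "insert \<phi> L' \<subseteq> ?E" by (auto intro: generated.base)
    with E \<phi> have "proper_extension L' ?E" by (auto simp: proper_extension_def extension_def)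
    with ext have "consistent ?E \<Longrightarrow> tabular ?E" .
    then show ?thesis
      using tabular_imp_tab by (cases "consistent ?E") (auto simp: consistent_def)
  qed
  then show ?rhs
    using sub generated_least[OF L' subset_refl] nt tabular_iff_tab[OF L'] by blast
next
  assume R: ?rhs
  then have "L' = generated L'" by (auto intro: generated.base)
  then have L': "tense_logic L'" using tense_logic_generated[OF L, of L'] R by simp
  have "tabular L''" if L'': "proper_extension L' L''" "consistent L''" for L''
  proof -
    from L''(1) obtain \<phi> where E: "tense_logic L''" "L' \<subseteq> L''" and \<phi>: "\<phi> \<in> L''" "\<phi> \<notin> L'"
      by (auto simp: proper_extension_def extension_def)
    from R \<phi>(2) obtain n where "tab n \<in> generated (insert \<phi> L')" by blast
    then have "tab n \<in> L''" using generated_least[OF E(1), of "insert \<phi> L'"] E(2) \<phi>(1) by auto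
    then show ?thesis
      using L''(2) tabular_iff_tab[OF E(1)] consistent_iff_Bot[OF E(1)] by blast
  qed
  then show "L' \<in> PTAB L"
    using R L' tabular_iff_tab[OF L'] by (auto simp: PTAB_def extension_def pretabular_def)
qed

text \<open>The condition on codes is arranged so that its logical form alone shows that it is Pi-0-2: membership in
  \<open>range gcode\<close> and in \<open>gcode ` generated \<Gamma>\<close> is Sigma-0-1, and the remaining atoms are decidable.\<close>

lemma code_PTAB_iff:
  assumes L: "tense_logic L"
  shows "b \<in> code_logic ` PTAB L \<longleftrightarrow>
    (\<forall>x. x \<in> b \<longrightarrow> x \<in> range gcode) \<and>
    (\<forall>x. x \<in> code_logic L \<longrightarrow> x \<in> b) \<and>
    (\<forall>x. x \<in> gcode ` generated {\<phi>. gcode \<phi> \<in> b} \<longrightarrow> x \<in> b) \<and>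
    (gcode Bot \<in> b \<or> (\<forall>n. gcode (tab n) \<notin> b)) \<and>
    (\<forall>x. x \<in> range gcode \<longrightarrow> x \<in> b \<or>
       (\<exists>n. gcode (tab n) \<in> gcode ` generated {\<phi>. gcode \<phi> = x \<or> gcode \<phi> \<in> b}))"
proof -
  let ?L = "{\<phi>. gcode \<phi> \<in> b}"
  have "b \<in> code_logic ` PTAB L \<longleftrightarrow> b \<subseteq> range gcode \<and> ?L \<in> PTAB L"
  proof
    assume "b \<in> code_logic ` PTAB L"
    then obtain L' where L': "L' \<in> PTAB L" and b: "b = gcode ` L'" by (auto simp: code_logic_def)
    have "?L = L'" unfolding b by auto
    with L' b show "b \<subseteq> range gcode \<and> ?L \<in> PTAB L" by auto
  next
    assume *: "b \<subseteq> range gcode \<and> ?L \<in> PTAB L"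
    then have "b = code_logic ?L" by (auto simp: code_logic_def)
    with * show "b \<in> code_logic ` PTAB L" by blast
  qed
  moreover have "b \<subseteq> range gcode \<longleftrightarrow> (\<forall>x. x \<in> b \<longrightarrow> x \<in> range gcode)"
    by (rule subset_iff)
  moreover have "L \<subseteq> ?L \<longleftrightarrow> (\<forall>x. x \<in> code_logic L \<longrightarrow> x \<in> b)"
    unfolding code_logic_def by blast
  moreover have "generated ?L \<subseteq> ?L \<longleftrightarrow> (\<forall>x. x \<in> gcode ` generated ?L \<longrightarrow> x \<in> b)"
    by blast
  moreover have "(Bot \<in> ?L \<or> (\<forall>n. tab n \<notin> ?L)) \<longleftrightarrow> (gcode Bot \<in> b \<or> (\<forall>n. gcode (tab n) \<notin> b))"
    by (simp only: mem_Collect_eq)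
  moreover have "(\<forall>\<phi>. \<phi> \<in> ?L \<or> (\<exists>n. tab n \<in> generated (insert \<phi> ?L))) \<longleftrightarrow>
      (\<forall>x. x \<in> range gcode \<longrightarrow> x \<in> b \<or>
        (\<exists>n. gcode (tab n) \<in> gcode ` generated {\<phi>. gcode \<phi> = x \<or> gcode \<phi> \<in> b}))"
  proof -
    have "insert \<phi> ?L = {\<psi>. gcode \<psi> = gcode \<phi> \<or> gcode \<psi> \<in> b}" for \<phi> by auto
    then show ?thesis
      by (simp only: inj_image_mem_iff[OF inj_gcode] mem_Collect_eq) blast
  qed
  ultimately show ?thesis
    unfolding PTAB_iff[OF L] by (simp only:)
qed

theorem lemma3p13:
  fixes L :: "form set"
  assumes "tense_logic L"
  shows "Pi02_in (code_logic L) (code_logic ` PTAB L)"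
proof (rule Pi02_in_if_pi02)
  show "pi02 (code_logic L) 0 (\<lambda>xs b. b \<in> code_logic ` PTAB L)"
    unfolding code_PTAB_iff[OF assms]
    by (rule pi02_and pi02_all pi02_imp_sigma pi02_or pi02_not_sigma sigma01_range_gcode sigma01_generated
        pi02_sigma computable_gcode_tab sigma01_rules recursive_rules | simp)+
qed

end
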